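(* Let $0<\gamma\le1$ and $\mu\colon\mathbb{C}\to[0,\infty)$, $\mu(z):=|\operatorname{Re}(z)|^\gamma$. Let $(a_n)_{n\in\mathbb{N}}$ be a strictly increasing real sequence with $a_n<0$ for all $n\in\mathbb{N}$ or $a_n\ge0$ for all $n\in\mathbb{N}$, and with $\lim_{n\to\infty}a_n=0$ or $\lim_{n\to\infty}a_n=\infty$. Let $\mathcal{V}:=(\exp(a_n\mu))_{n\in\mathbb{N}}$ and $\Omega_n:=S_n:=\{z\in\mathbb{C}: |\operatorname{Im}(z)|<n\}$ for all $n\in\mathbb{N}$. Then $\mathcal{OV}(\mathbb{C})$ satisfies property $(\Omega)$.
   Context: $\mathbb{N}=\{1,2,\dots\}$. $\mathcal{OV}(\mathbb{C})$ is the space of entire functions $f\colon\mathbb{C}\to\mathbb{C}$ with $|f|_n:=\sup_{z\in\Omega_n}|f(z)|e^{a_n\mu(z)}<\infty$ for all $n\in\mathbb{N}$, a Fréchet space with the increasing system of seminorms $(|\cdot|_n)_{n\in\mathbb{N}}$. A Fréchet space $F$ with increasing fundamental system of seminorms $(\|\cdot\|_k)_{k\in\mathbb{N}}$ and $U_k:=\{x\in F:\|x\|_k\le1\}$ satisfies property $(\Omega)$ if $\forall p\in\mathbb{N}\,\exists q\in\mathbb{N}\,\forall k\in\mathbb{N}\,\exists n\in\mathbb{N},C>0\,\forall r>0:\ U_q\subset Cr^nU_k+\frac1rU_p$. *)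

theory Defs
  imports "HOL-Complex_Analysis.Complex_Analysis" "HOL-Library.Function_Algebras"
begin

text \<open>A complex Frechet space, presented as a linear subspace \<open>E\<close> of an ambient complex vector
  space together with an increasing sequence \<open>p 1 \<le> p 2 \<le> \<dots>\<close> of seminorms on \<open>E\<close> that defines a
  Hausdorff and (sequentially) complete topology.  The index set is \<open>{1, 2, \<dots>}\<close>; the value
  \<open>p 0\<close> is never used.\<close>

locale frechet_space = vector_space scale
  for scale :: "complex \<Rightarrow> 'v::ab_group_add \<Rightarrow> 'v" +
  fixes E :: "'v set" and p :: "nat \<Rightarrow> 'v \<Rightarrow> real"
  assumes subspace_E: "subspace E"
    and seminorm_scale: "1 \<le> k \<Longrightarrow> x \<in> E \<Longrightarrow> p k (scale c x) = norm c * p k x"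
    and seminorm_triangle: "1 \<le> k \<Longrightarrow> x \<in> E \<Longrightarrow> y \<in> E \<Longrightarrow> p k (x + y) \<le> p k x + p k y"
    and seminorm_nonneg: "1 \<le> k \<Longrightarrow> x \<in> E \<Longrightarrow> 0 \<le> p k x"
    and seminorm_increasing: "1 \<le> k \<Longrightarrow> x \<in> E \<Longrightarrow> p k x \<le> p (Suc k) x"
    and seminorms_separating: "x \<in> E \<Longrightarrow> (\<And>k. 1 \<le> k \<Longrightarrow> p k x = 0) \<Longrightarrow> x = 0"
    and complete:
      "\<And>X :: nat \<Rightarrow> 'v. range X \<subseteq> E \<Longrightarrow>
         (\<And>k e. 1 \<le> k \<Longrightarrow> 0 < e \<Longrightarrow> \<exists>N. \<forall>m\<ge>N. \<forall>j\<ge>N. p k (X m - X j) < e) \<Longrightarrow>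
         \<exists>x\<in>E. \<forall>k\<ge>1. (\<lambda>m. p k (X m - x)) \<longlonglongrightarrow> 0"
begin

definition seminorm_ball :: "nat \<Rightarrow> 'v set" where
  "seminorm_ball k = {x \<in> E. p k x \<le> 1}"

definition property_Omega :: bool where
  "property_Omega \<longleftrightarrow>
    (\<forall>m\<ge>1. \<exists>q\<ge>1. \<forall>k\<ge>1. \<exists>n\<ge>1. \<exists>C>0. \<forall>r::real. r > 0 \<longrightarrow>
      seminorm_ball q \<subseteq>
        {scale (complex_of_real (C * r ^ n)) u + scale (complex_of_real (1 / r)) v | u v.
           u \<in> seminorm_ball k \<and> v \<in> seminorm_ball m})"

end

definition fun_scale :: "complex \<Rightarrow> (complex \<Rightarrow> complex) \<Rightarrow> complex \<Rightarrow> complex" where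
  "fun_scale c f = (\<lambda>z. c * f z)"

text \<open>The supremum below is taken in \<open>real\<close>, so it is meaningful only where the set of
  values is bounded, which is what membership in \<open>OV\<close> requires.\<close>

definition weighted_seminorm ::
  "(nat \<Rightarrow> complex set) \<Rightarrow> (nat \<Rightarrow> complex \<Rightarrow> real) \<Rightarrow> nat \<Rightarrow> (complex \<Rightarrow> complex) \<Rightarrow> real" where
  "weighted_seminorm \<Omega> V n f = (SUP z\<in>\<Omega> n. norm (f z) * V n z)"

definition OV ::
  "(nat \<Rightarrow> complex set) \<Rightarrow> (nat \<Rightarrow> complex \<Rightarrow> real) \<Rightarrow> (complex \<Rightarrow> complex) set" where
  "OV \<Omega> V = {f. f holomorphic_on UNIV \<and>
                (\<forall>n\<ge>1. bdd_above ((\<lambda>z. norm (f z) * V n z) ` \<Omega> n))}"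

definition strip :: "nat \<Rightarrow> complex set" where
  "strip n = {z. \<bar>Im z\<bar> < real n}"

lemma vector_space_fun_scale: "vector_space fun_scale"
  by unfold_locales (auto simp: fun_scale_def fun_eq_iff algebra_simps)

lemma weighted_seminorm_upper:
  assumes "f \<in> OV \<Omega> V" "1 \<le> n" "z \<in> \<Omega> n"
  shows "norm (f z) * V n z \<le> weighted_seminorm \<Omega> V n f"
  unfolding weighted_seminorm_def using assms by (intro cSUP_upper) (auto simp: OV_def)

lemma weighted_seminorm_least:
  assumes "\<Omega> n \<noteq> {}" "\<And>z. z \<in> \<Omega> n \<Longrightarrow> norm (f z) * V n z \<le> B"
  shows "weighted_seminorm \<Omega> V n f \<le> B"
  unfolding weighted_seminorm_def using assms by (intro cSUP_least)

lemma OV_I: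
  assumes "f holomorphic_on UNIV"
    and "\<And>n. 1 \<le> n \<Longrightarrow> \<exists>B. \<forall>z\<in>\<Omega> n. norm (f z) * V n z \<le> B"
  shows "f \<in> OV \<Omega> V"
  using assms unfolding OV_def bdd_above_def by fastforce

lemma strip_nonempty: "1 \<le> n \<Longrightarrow> strip n \<noteq> {}"
  by (auto simp: strip_def intro!: exI[of _ 0])

lemma frechet_space_OV_strip:
  assumes V_cont: "\<And>n. 1 \<le> n \<Longrightarrow> continuous_on UNIV (V n)"
    and V_pos: "\<And>n z. 1 \<le> n \<Longrightarrow> 0 < V n z"
    and V_mono: "\<And>n z. 1 \<le> n \<Longrightarrow> V n z \<le> V (Suc n) z"
  shows "frechet_space fun_scale (OV strip V) (weighted_seminorm strip V)"
proof -
  interpret vector_space fun_scale by (rule vector_space_fun_scale)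
  let ?p = "weighted_seminorm strip V" and ?E = "OV strip V"
  have up: "norm (f z) * V n z \<le> ?p n f" if "f \<in> ?E" "1 \<le> n" "z \<in> strip n" for f n z
    by (rule weighted_seminorm_upper[OF that])
  have least: "?p n f \<le> B" if "1 \<le> n" "\<And>z. z \<in> strip n \<Longrightarrow> norm (f z) * V n z \<le> B" for f n B
    by (intro weighted_seminorm_least strip_nonempty that(1)) (rule that(2))
  have tri: "norm (f z + g z) * V n z \<le> norm (f z) * V n z + norm (g z) * V n z"
    if "1 \<le> n" for f g :: "complex \<Rightarrow> complex" and n z
    using mult_right_mono[OF norm_triangle_ineq[of "f z" "g z"], of "V n z"] V_pos[OF that, of z]
    by (simp add: distrib_right)
  have zeroE: "0 \<in> ?E" by (rule OV_I) (auto simp: zero_fun_def)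
  have addE: "f + g \<in> ?E" if "f \<in> ?E" "g \<in> ?E" for f g
  proof (rule OV_I)
    show "f + g holomorphic_on UNIV"
      using that unfolding OV_def plus_fun_def by (auto intro: holomorphic_intros)
    fix n :: nat assume n: "1 \<le> n"
    have "norm ((f + g) z) * V n z \<le> ?p n f + ?p n g" if "z \<in> strip n" for z
      using tri[OF n, of f z g] up[of f n z] up[of g n z] that n \<open>f \<in> ?E\<close> \<open>g \<in> ?E\<close> by simp
    then show "\<exists>B. \<forall>z\<in>strip n. norm ((f + g) z) * V n z \<le> B" by blast
  qed
  have scE: "fun_scale c f \<in> ?E" if "f \<in> ?E" for c f
  proof (rule OV_I)
    show "fun_scale c f holomorphic_on UNIV"
      using that unfolding OV_def fun_scale_def by (auto intro: holomorphic_intros)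
    fix n :: nat assume n: "1 \<le> n"
    have "norm (fun_scale c f z) * V n z \<le> norm c * ?p n f" if "z \<in> strip n" for z
      using mult_left_mono[OF up[OF \<open>f \<in> ?E\<close> n that], of "norm c"]
      by (simp add: fun_scale_def norm_mult mult.assoc)
    then show "\<exists>B. \<forall>z\<in>strip n. norm (fun_scale c f z) * V n z \<le> B" by blast
  qed
  have sub: "subspace ?E" using zeroE addE scE by (auto simp: subspace_def)
  have nonneg: "0 \<le> ?p n f" if "1 \<le> n" "f \<in> ?E" for n f
  proof -
    have "0 \<in> strip n" using that by (simp add: strip_def)
    moreover have "0 \<le> norm (f 0) * V n 0" using V_pos[OF that(1), of 0] by simp
    ultimately show ?thesis using up[of f n 0] that by linarith
  qed
  have sc_le: "?p n (fun_scale c f) \<le> norm c * ?p n f" if "1 \<le> n" "f \<in> ?E" for n c f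
  proof (rule least[OF that(1)])
    fix z assume "z \<in> strip n"
    from mult_left_mono[OF up[OF that(2,1) this], of "norm c"]
    show "norm (fun_scale c f z) * V n z \<le> norm c * ?p n f"
      by (simp add: fun_scale_def norm_mult mult.assoc)
  qed
  have sc: "?p n (fun_scale c f) = norm c * ?p n f" if n: "1 \<le> n" and f: "f \<in> ?E" for n c f
  proof (cases "c = 0")
    case True
    then show ?thesis using sc_le[OF that, of c] nonneg[OF n scE[OF f, of c]] by simp
  next
    case False
    have "fun_scale (inverse c) (fun_scale c f) = f"
      using False by (simp add: fun_scale_def fun_eq_iff)
    with sc_le[OF n scE[OF f, of c], of "inverse c"]
    have "?p n f \<le> norm (inverse c) * ?p n (fun_scale c f)" by simp
    from mult_left_mono[OF this, of "norm c"] False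
    have "norm c * ?p n f \<le> ?p n (fun_scale c f)"
      by (simp add: norm_inverse mult.assoc[symmetric])
    with sc_le[OF that, of c] show ?thesis by linarith
  qed
  have incr: "?p k f \<le> ?p (Suc k) f" if k: "1 \<le> k" and f: "f \<in> ?E" for k f
  proof (rule least[OF k])
    fix z assume z: "z \<in> strip k"
    have "norm (f z) * V k z \<le> norm (f z) * V (Suc k) z"
      using V_mono[OF k] by (intro mult_left_mono) auto
    also have "\<dots> \<le> ?p (Suc k) f" using z f by (intro up) (auto simp: strip_def)
    finally show "norm (f z) * V k z \<le> ?p (Suc k) f" .
  qed
  have in_strip: "\<exists>n\<ge>1. z \<in> strip n" for z
  proof -
    obtain n where "\<bar>Im z\<bar> < real n" using reals_Archimedean2 by blast
    then show ?thesis by (intro exI[of _ n]) (auto simp: strip_def Suc_le_eq intro: Nat.gr0I)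
  qed
  have sep: "f = 0" if f: "f \<in> ?E" and 0: "\<And>k. 1 \<le> k \<Longrightarrow> ?p k f = 0" for f
  proof
    fix z
    obtain n where n: "1 \<le> n" "z \<in> strip n" using in_strip by blast
    have "norm (f z) * V n z \<le> 0" using up[OF f n] 0[OF n(1)] by simp
    then show "f z = 0 z" using V_pos[OF n(1), of z] by (auto simp: mult_le_0_iff)
  qed
  have compl: "\<exists>g\<in>?E. \<forall>k\<ge>1. (\<lambda>m. ?p k (X m - g)) \<longlonglongrightarrow> 0"
    if X: "range X \<subseteq> ?E"
      and C: "\<And>k e. 1 \<le> k \<Longrightarrow> 0 < e \<Longrightarrow> \<exists>N. \<forall>m\<ge>N. \<forall>j\<ge>N. ?p k (X m - X j) < e"
    for X :: "nat \<Rightarrow> complex \<Rightarrow> complex"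
  proof -
    have XE: "X m \<in> ?E" for m using X by auto
    have XdE: "X m - X j \<in> ?E" for m j using subspace_diff[OF sub] XE by blast
    have pt: "norm (X m z - X j z) * V n z \<le> ?p n (X m - X j)"
      if "1 \<le> n" "z \<in> strip n" for m j n z
      using up[OF XdE that] by simp
    have ucauchy: "uniformly_Cauchy_on (cball w 1) X" for w
    proof -
      obtain n where n: "\<bar>Im w\<bar> + 1 < real n" using reals_Archimedean2 by blast
      then have n1: "1 \<le> n" by (cases n) auto
      have sub': "z \<in> strip n" if "z \<in> cball w 1" for z
        using that n abs_Im_le_cmod[of "w - z"] by (auto simp: strip_def dist_norm)
      have "continuous_on (cball w 1) (V n)"
        using continuous_on_subset[OF V_cont[OF n1]] by blast
      then have "\<exists>x\<in>cball w 1. \<forall>y\<in>cball w 1. V n x \<le> V n y"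
        by (intro continuous_attains_inf) auto
      then obtain z0 where z0: "\<And>z. z \<in> cball w 1 \<Longrightarrow> V n z0 \<le> V n z" by blast
      show ?thesis
        unfolding uniformly_Cauchy_on_def
      proof (intro allI impI)
        fix e :: real assume e: "0 < e"
        obtain N where N: "\<forall>m\<ge>N. \<forall>j\<ge>N. ?p n (X m - X j) < e * V n z0"
          using C[OF n1, of "e * V n z0"] e V_pos[OF n1, of z0] by auto
        have "dist (X m z) (X j z) < e" if z: "z \<in> cball w 1" and mj: "m \<ge> N" "j \<ge> N" for z m j
        proof -
          have "norm (X m z - X j z) * V n z0 \<le> norm (X m z - X j z) * V n z"
            using z0[OF z] by (intro mult_left_mono) auto
          also have "\<dots> < e * V n z0" using pt[OF n1 sub'[OF z], of m j] N mj by force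
          finally show ?thesis using V_pos[OF n1, of z0] by (simp add: dist_norm)
        qed
        then show "\<exists>M. \<forall>x\<in>cball w 1. \<forall>m\<ge>M. \<forall>n\<ge>M. dist (X m x) (X n x) < e" by blast
      qed
    qed
    define g where "g z = lim (\<lambda>m. X m z)" for z
    have ulim: "uniform_limit (cball w 1) X g sequentially" for w
    proof -
      obtain l where l: "uniform_limit (cball w 1) X l sequentially"
        using Cauchy_uniformly_convergent[OF ucauchy] uniformly_convergent_on_def by blast
      have "l z = g z" if "z \<in> cball w 1" for z
        unfolding g_def using tendsto_uniform_limitI[OF l that] by (simp add: limI)
      then show ?thesis using l by (subst uniform_limit_cong'[where g = X and i = l]) auto
    qed
    have lim: "(\<lambda>m. X m z) \<longlonglongrightarrow> g z" for z
      using tendsto_uniform_limitI[OF ulim[of z]] by simp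
    have holo: "g holomorphic_on UNIV"
    proof (rule holomorphic_uniform_sequence[where f = X])
      show "X m holomorphic_on UNIV" for m using XE[of m] by (simp add: OV_def)
      show "\<exists>d>0. cball x d \<subseteq> UNIV \<and> uniform_limit (cball x d) X g sequentially" for x
        using ulim[of x] by (intro exI[of _ 1]) auto
    qed simp
    have close: "\<exists>N. \<forall>m\<ge>N. \<forall>z\<in>strip n. norm (X m z - g z) * V n z \<le> e"
      if n: "1 \<le> n" and e: "0 < e" for n e
    proof -
      obtain N where N: "\<forall>m\<ge>N. \<forall>j\<ge>N. ?p n (X m - X j) < e" using C[OF n e] by blast
      have "norm (X m z - g z) * V n z \<le> e" if m: "m \<ge> N" and z: "z \<in> strip n" for m z
      proof (rule Lim_bounded[of "\<lambda>j. norm (X m z - X j z) * V n z" _ N])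
        show "(\<lambda>j. norm (X m z - X j z) * V n z) \<longlonglongrightarrow> norm (X m z - g z) * V n z"
          by (intro tendsto_intros lim)
        show "\<forall>j\<ge>N. norm (X m z - X j z) * V n z \<le> e"
          using pt[OF n z, of m] N m by (metis less_eq_real_def order_trans)
      qed
      then show ?thesis by blast
    qed
    have gE: "g \<in> ?E"
    proof (rule OV_I[OF holo])
      fix n :: nat assume n: "1 \<le> n"
      obtain N where N: "\<forall>m\<ge>N. \<forall>z\<in>strip n. norm (X m z - g z) * V n z \<le> 1"
        using close[OF n, of 1] by auto
      have "norm (g z) * V n z \<le> 1 + ?p n (X N)" if z: "z \<in> strip n" for z
        using tri[OF n, of "\<lambda>z. g z - X N z" z "X N"] N z up[OF XE n z, of N]
        by (fastforce simp: norm_minus_commute)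
      then show "\<exists>B. \<forall>z\<in>strip n. norm (g z) * V n z \<le> B" by blast
    qed
    have XgE: "X m - g \<in> ?E" for m using subspace_diff[OF sub XE gE] .
    have "(\<lambda>m. ?p k (X m - g)) \<longlonglongrightarrow> 0" if k: "1 \<le> k" for k
    proof (rule LIMSEQ_I)
      fix e :: real assume e: "0 < e"
      obtain N where N: "\<forall>m\<ge>N. \<forall>z\<in>strip k. norm (X m z - g z) * V k z \<le> e / 2"
        using close[OF k, of "e / 2"] e by auto
      have "norm (?p k (X m - g) - 0) < e" if m: "m \<ge> N" for m
      proof -
        have "?p k (X m - g) \<le> e / 2" using N m by (intro least[OF k]) auto
        then show ?thesis using nonneg[OF k XgE, of m] e by simp
      qed
      then show "\<exists>no. \<forall>n\<ge>no. norm (?p k (X n - g) - 0) < e" by blast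
    qed
    with gE show ?thesis by blast
  qed
  show ?thesis
  proof unfold_locales
    show "?p k (f + g) \<le> ?p k f + ?p k g" if "1 \<le> k" "f \<in> ?E" "g \<in> ?E" for k f g
    proof (rule least[OF that(1)])
      fix z assume "z \<in> strip k"
      then show "norm ((f + g) z) * V k z \<le> ?p k f + ?p k g"
        using tri[OF that(1), of f z g] up[of f k z] up[of g k z] that by simp
    qed
  qed (use sub sc nonneg incr sep compl in auto)
qed

corollary frechet_space_OV_exp:
  fixes \<gamma> :: real and a :: "nat \<Rightarrow> real"
  assumes "0 < \<gamma>" "strict_mono_on {1..} a"
  shows "frechet_space fun_scale
     (OV strip (\<lambda>n z. exp (a n * \<bar>Re z\<bar> powr \<gamma>)))
     (weighted_seminorm strip (\<lambda>n z. exp (a n * \<bar>Re z\<bar> powr \<gamma>)))"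
proof (rule frechet_space_OV_strip)
  show "continuous_on UNIV (\<lambda>z. exp (a n * \<bar>Re z\<bar> powr \<gamma>))" for n
    using assms(1) by (intro continuous_intros continuous_on_powr') auto
  show "exp (a n * \<bar>Re z\<bar> powr \<gamma>) \<le> exp (a (Suc n) * \<bar>Re z\<bar> powr \<gamma>)" if "1 \<le> n" for n z
    using strict_mono_onD[OF assms(2), of n "Suc n"] that by (auto intro!: mult_right_mono)
qed simp

end

theory Submission
  imports Defs "HOL-Real_Asymp.Real_Asymp"
begin

text \<open>
  Given \<open>m\<close>, take \<open>q = m + 1\<close>.  A function \<open>f\<close> in the unit ball of the \<open>q\<close>-th seminorm has to be written
  as \<open>u + v\<close> with \<open>v\<close> of size \<open>1 / r\<close> in the \<open>m\<close>-th seminorm and \<open>u\<close> of size at most a power of \<open>r\<close> in the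
  \<open>k\<close>-th.  Two resources are available: \<open>f\<close> is controlled on a strip that is wider than \<open>strip m\<close>,
  and its weight is stronger than the \<open>m\<close>-th one.  The first pays for discarding high frequencies,
  the second for discarding large real parts.

  Accordingly \<open>u\<close> is the convolution of \<open>f\<close>, restricted to a real interval \<open>[- T, T]\<close>, with the entire
  kernel \<open>K w = exp (- w\<^sup>2) * sin (R * w) / (pi * w)\<close>.  Integration over the whole real line would
  reproduce \<open>f\<close> up to an error of size \<open>exp (- R / 2)\<close>: the two exponentials that make up the sine are
  moved to opposite edges of a wider strip, where they are small, and the pole that is crossed
  contributes \<open>f\<close> (\<open>cutoff_reproduction\<close>, \<open>convolution_error_finite_window\<close>).  Cutting at \<open>\<bar>t\<bar> = T\<close> costs
  at most \<open>exp (R * (m + 1) - (a q - a m) * T powr \<gamma>)\<close>, up to a constant factor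
  (\<open>truncated_convolution_tail_le\<close>).  On the other hand the entire function \<open>u\<close> is bounded on \<open>strip k\<close>
  with the \<open>k\<close>-th weight by a multiple of \<open>exp (R * (k + 1) + \<bar>a k - a q\<bar> * T powr \<gamma>)\<close>
  (\<open>truncated_convolution_le\<close>).  If \<open>R\<close> and \<open>T powr \<gamma>\<close> are suitable multiples of \<open>ln r\<close>, up to
  additive constants, the errors become \<open>1 / r\<close> and the bound on \<open>u\<close> a power of \<open>r\<close> (\<open>weighted_strip_decomposition\<close>).

  The weights survive all convolutions because \<open>\<bar>x\<bar> powr \<gamma>\<close> is subadditive for \<open>\<gamma> \<le> 1\<close> and grows at
  most linearly, whereas the kernel decays like a Gaussian (\<open>gauss_transfers_weight\<close>).
\<close>

section \<open>Weights and the Gaussian\<close>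

text \<open>Concavity of \<open>t powr \<gamma>\<close>: with \<open>s = \<bar>x\<bar> + \<bar>y\<bar>\<close>, the fractions \<open>\<bar>x\<bar> / s\<close> and \<open>\<bar>y\<bar> / s\<close> sum to 1
  and only grow when raised to a power \<open>\<gamma> \<le> 1\<close>.\<close>

lemma abs_powr_add_le:
  fixes x y :: real
  assumes "0 < \<gamma>" "\<gamma> \<le> 1"
  shows "\<bar>x + y\<bar> powr \<gamma> \<le> \<bar>x\<bar> powr \<gamma> + \<bar>y\<bar> powr \<gamma>"
proof (cases "\<bar>x\<bar> + \<bar>y\<bar> = 0")
  case True
  then have "x = 0" "y = 0" by linarith+
  then show ?thesis by simp
next
  case False
  define s where "s = \<bar>x\<bar> + \<bar>y\<bar>"
  have s: "0 < s" using False by (simp add: s_def)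
  have frac: "t / s * s powr \<gamma> \<le> t powr \<gamma>" if "0 \<le> t" "t \<le> s" for t
  proof (cases "t = 0")
    case False
    have "(t / s) powr 1 \<le> (t / s) powr \<gamma>"
      using that s False assms by (intro powr_mono') auto
    then have "t / s * s powr \<gamma> \<le> (t / s) powr \<gamma> * s powr \<gamma>"
      using that s False by (intro mult_right_mono) auto
    also have "\<dots> = t powr \<gamma>" using that s by (simp add: powr_divide)
    finally show ?thesis .
  qed simp
  have "\<bar>x + y\<bar> powr \<gamma> \<le> s powr \<gamma>"
    using assms by (intro powr_mono2) (auto simp: s_def)
  also have "s powr \<gamma> = \<bar>x\<bar> / s * s powr \<gamma> + \<bar>y\<bar> / s * s powr \<gamma>"
    using s by (simp add: s_def add_divide_distrib[symmetric] distrib_right[symmetric])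
  also have "\<dots> \<le> \<bar>x\<bar> powr \<gamma> + \<bar>y\<bar> powr \<gamma>"
    by (intro add_mono frac) (auto simp: s_def)
  finally show ?thesis .
qed

lemma abs_powr_le_one_add:
  fixes x :: real
  assumes "0 < \<gamma>" "\<gamma> \<le> 1"
  shows "\<bar>x\<bar> powr \<gamma> \<le> 1 + \<bar>x\<bar>"
proof (cases "\<bar>x\<bar> \<le> 1")
  case True
  then have "\<bar>x\<bar> powr \<gamma> \<le> 1" using assms by (intro powr_le1) auto
  then show ?thesis by simp
next
  case False
  then have "\<bar>x\<bar> powr \<gamma> \<le> \<bar>x\<bar> powr 1" using assms by (intro powr_mono) auto
  then show ?thesis by simp
qed

text \<open>An upper bound for the cost of moving a weight \<open>exp (- b * \<bar>t\<bar> powr \<gamma>)\<close> from one point to another against a Gaussian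
  factor.  It depends neither on \<open>\<gamma>\<close> nor on the points.\<close>

definition transfer_const :: "real \<Rightarrow> real" where
  "transfer_const b = 2 * exp (\<bar>b\<bar> + b\<^sup>2 / 2)"

lemma transfer_const_pos: "0 < transfer_const b"
  by (simp add: transfer_const_def)

text \<open>Half of the Gaussian pays for the exponential, since \<open>\<bar>b\<bar> * \<bar>w\<bar> \<le> b\<^sup>2 / 2 + w\<^sup>2 / 2\<close>; the other half
  pays for \<open>1 + w\<^sup>2\<close>.  The rational bound is kept because its integral is an arctangent.\<close>

lemma gauss_absorbs_exp:
  fixes w :: real
  shows "exp (\<bar>b\<bar> * (1 + \<bar>w\<bar>)) * exp (- w\<^sup>2) \<le> transfer_const b / (1 + w\<^sup>2)"
proof -
  have lin: "1 + w\<^sup>2 \<le> 2 * exp (w\<^sup>2 / 2)"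
    using exp_ge_add_one_self[of "w\<^sup>2 / 2"] zero_le_power2[of w] by linarith
  have sq: "exp (\<bar>b\<bar> * (1 + \<bar>w\<bar>)) * exp (- w\<^sup>2) \<le> exp (\<bar>b\<bar> + b\<^sup>2 / 2) * exp (- (w\<^sup>2 / 2))"
  proof -
    have "0 \<le> (\<bar>b\<bar> - \<bar>w\<bar>)\<^sup>2" by simp
    then have "\<bar>b\<bar> * \<bar>w\<bar> \<le> b\<^sup>2 / 2 + w\<^sup>2 / 2" by (simp add: power2_diff)
    then show ?thesis unfolding exp_add[symmetric] by (simp add: algebra_simps)
  qed
  have "exp (\<bar>b\<bar> * (1 + \<bar>w\<bar>)) * exp (- w\<^sup>2) * (1 + w\<^sup>2)
      \<le> (exp (\<bar>b\<bar> + b\<^sup>2 / 2) * exp (- (w\<^sup>2 / 2))) * (2 * exp (w\<^sup>2 / 2))"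
    by (rule mult_mono[OF sq lin]) auto
  also have "\<dots> = transfer_const b * (exp (- (w\<^sup>2 / 2)) * exp (w\<^sup>2 / 2))"
    by (simp only: transfer_const_def mult_ac)
  also have "\<dots> = transfer_const b" by (simp only: exp_add[symmetric]) simp
  finally show ?thesis by (simp add: pos_le_divide_eq add_pos_nonneg)
qed

text \<open>Subadditivity of \<open>\<bar>x\<bar> powr \<gamma>\<close> bounds the quotient of the weights at \<open>x\<close> and \<open>t\<close> by
  \<open>exp (\<bar>b\<bar> * (1 + \<bar>x - t\<bar>))\<close>, for either sign of \<open>b\<close>, and the Gaussian absorbs this.  As a
  consequence, convolution with a Gaussian kernel respects every weight of the family.\<close>

lemma gauss_transfers_weight:
  fixes x t :: real
  assumes "0 < \<gamma>" "\<gamma> \<le> 1"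
  shows "exp (- (b * \<bar>t\<bar> powr \<gamma>)) * exp (- (x - t)\<^sup>2)
    \<le> transfer_const b * exp (- (b * \<bar>x\<bar> powr \<gamma>)) / (1 + (t - x)\<^sup>2)"
proof -
  have "b * (\<bar>x\<bar> powr \<gamma> - \<bar>t\<bar> powr \<gamma>) \<le> \<bar>b\<bar> * \<bar>x - t\<bar> powr \<gamma>"
  proof -
    have "\<bar>\<bar>x\<bar> powr \<gamma> - \<bar>t\<bar> powr \<gamma>\<bar> \<le> \<bar>x - t\<bar> powr \<gamma>"
      using abs_powr_add_le[OF assms, of "x - t" t] abs_powr_add_le[OF assms, of "t - x" x]
      by (simp add: abs_le_iff abs_minus_commute[of t x])
    then have "\<bar>b\<bar> * \<bar>\<bar>x\<bar> powr \<gamma> - \<bar>t\<bar> powr \<gamma>\<bar> \<le> \<bar>b\<bar> * \<bar>x - t\<bar> powr \<gamma>"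
      by (intro mult_left_mono) auto
    then show ?thesis by (metis abs_ge_self abs_mult order_trans)
  qed
  also have "\<dots> \<le> \<bar>b\<bar> * (1 + \<bar>x - t\<bar>)"
    using abs_powr_le_one_add[OF assms] by (intro mult_left_mono) auto
  finally have "exp (- (b * \<bar>t\<bar> powr \<gamma>)) \<le> exp (- (b * \<bar>x\<bar> powr \<gamma>)) * exp (\<bar>b\<bar> * (1 + \<bar>x - t\<bar>))"
    unfolding exp_add[symmetric] by (simp add: algebra_simps)
  then have "exp (- (b * \<bar>t\<bar> powr \<gamma>)) * exp (- (x - t)\<^sup>2)
     \<le> exp (- (b * \<bar>x\<bar> powr \<gamma>)) * (exp (\<bar>b\<bar> * (1 + \<bar>x - t\<bar>)) * exp (- (x - t)\<^sup>2))"
    by (simp add: mult.assoc[symmetric] mult_right_mono)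
  also have "\<dots> \<le> exp (- (b * \<bar>x\<bar> powr \<gamma>)) * (transfer_const b / (1 + (x - t)\<^sup>2))"
    by (intro mult_left_mono gauss_absorbs_exp) auto
  finally show ?thesis by (simp add: power2_commute mult.commute)
qed

section \<open>Integrals along horizontal and vertical segments\<close>

text \<open>The bound is uniform in the length of the segment because \<open>1 / (1 + (s - x)\<^sup>2)\<close> has total integral
  \<open>pi\<close>.\<close>

lemma norm_contour_integral_horizontal_le:
  assumes cont: "continuous_on (closed_segment (Complex \<alpha> c) (Complex \<beta> c)) g"
    and "\<alpha> \<le> \<beta>" "0 \<le> D"
    and bd: "\<And>s. \<alpha> \<le> s \<Longrightarrow> s \<le> \<beta> \<Longrightarrow> norm (g (Complex s c)) \<le> D / (1 + (s - x)\<^sup>2)"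
  shows "norm (contour_integral (linepath (Complex \<alpha> c) (Complex \<beta> c)) g) \<le> D * pi"
proof -
  let ?l = "linepath (Complex \<alpha> c) (Complex \<beta> c)" and ?s = "\<lambda>t. \<alpha> + (\<beta> - \<alpha>) * t"
  have l: "?l t = Complex (?s t) c" for t
    by (simp add: linepath_def complex_eq_iff algebra_simps)
  have d: "Complex \<beta> c - Complex \<alpha> c = of_real (\<beta> - \<alpha>)" by (simp add: complex_eq_iff)
  have "(g has_contour_integral contour_integral ?l g) ?l"
    by (intro has_contour_integral_integral contour_integrable_continuous_linepath cont)
  then have gi: "((\<lambda>t. g (?l t) * of_real (\<beta> - \<alpha>)) has_integral contour_integral ?l g) {0..1}"
    unfolding has_contour_integral_linepath d .
  have fi: "((\<lambda>t. D * (\<beta> - \<alpha>) / (1 + (?s t - x)\<^sup>2)) has_integral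
      D * arctan (?s 1 - x) - D * arctan (?s 0 - x)) {0..1}"
  proof (rule fundamental_theorem_of_calculus)
    show "((\<lambda>t. D * arctan (?s t - x)) has_vector_derivative D * (\<beta> - \<alpha>) / (1 + (?s t - x)\<^sup>2))
        (at t within {0..1})" for t
      unfolding has_real_derivative_iff_has_vector_derivative[symmetric]
      by (auto intro!: derivative_eq_intros simp: field_simps)
  qed simp
  have "norm (integral {0..1} (\<lambda>t. g (?l t) * of_real (\<beta> - \<alpha>)))
      \<le> integral {0..1} (\<lambda>t. D * (\<beta> - \<alpha>) / (1 + (?s t - x)\<^sup>2))"
  proof (rule integral_norm_bound_integral)
    fix t :: real assume t: "t \<in> {0..1}"
    have "(\<beta> - \<alpha>) * t \<le> (\<beta> - \<alpha>) * 1" "0 \<le> (\<beta> - \<alpha>) * t"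
      using t \<open>\<alpha> \<le> \<beta>\<close> by (intro mult_left_mono; simp) (use t \<open>\<alpha> \<le> \<beta>\<close> in simp)
    then have "norm (g (?l t)) \<le> D / (1 + (?s t - x)\<^sup>2)"
      unfolding l by (intro bd) auto
    from mult_right_mono[OF this, of "\<beta> - \<alpha>"] \<open>\<alpha> \<le> \<beta>\<close>
    show "norm (g (?l t) * of_real (\<beta> - \<alpha>)) \<le> D * (\<beta> - \<alpha>) / (1 + (?s t - x)\<^sup>2)"
      by (simp add: norm_mult del: of_real_diff)
  qed (use gi fi in auto)
  also have "\<dots> = D * (arctan (\<beta> - x) - arctan (\<alpha> - x))"
    using fi by (simp add: integral_unique algebra_simps)
  also have "\<dots> \<le> D * pi"
    using arctan_lbound[of "\<alpha> - x"] arctan_ubound[of "\<beta> - x"] \<open>0 \<le> D\<close>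
    by (intro mult_left_mono) auto
  finally show ?thesis unfolding integral_unique[OF gi] .
qed

lemma norm_contour_integral_vertical_le:
  assumes "continuous_on (closed_segment (Complex m y1) (Complex m y2)) g"
    and "\<bar>y1\<bar> \<le> c" "\<bar>y2\<bar> \<le> c" "0 \<le> B"
    and bd: "\<And>t. Re t = m \<Longrightarrow> \<bar>Im t\<bar> \<le> c \<Longrightarrow> norm (g t) \<le> B"
  shows "norm (contour_integral (linepath (Complex m y1) (Complex m y2)) g) \<le> 2 * c * B"
proof -
  have "norm (contour_integral (linepath (Complex m y1) (Complex m y2)) g)
      \<le> B * norm (Complex m y2 - Complex m y1)"
  proof (rule contour_integral_bound_linepath)
    fix t assume "t \<in> closed_segment (Complex m y1) (Complex m y2)"
    then have "Re t = m" "Im t \<in> closed_segment y1 y2" by (simp_all add: closed_segment_same_Re)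
    then show "norm (g t) \<le> B"
      using assms(2,3) by (intro bd) (auto simp: closed_segment_eq_real_ivl split: if_splits)
  qed (use assms in \<open>auto intro: contour_integrable_continuous_linepath\<close>)
  also have "norm (Complex m y2 - Complex m y1) = \<bar>y2 - y1\<bar>"
    by (simp add: cmod_def)
  also have "B * \<bar>y2 - y1\<bar> \<le> B * (2 * c)"
    using assms by (intro mult_left_mono) auto
  finally show ?thesis by (simp add: mult_ac)
qed

lemma contour_integral_rectpath_sides:
  assumes "continuous_on (path_image (rectpath a1 a3)) h" "Re a1 \<le> Re a3" "Im a1 \<le> Im a3"
  defines "a2 \<equiv> Complex (Re a3) (Im a1)" and "a4 \<equiv> Complex (Re a1) (Im a3)"
  shows "contour_integral (rectpath a1 a3) h = contour_integral (linepath a1 a2) h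
     + contour_integral (linepath a2 a3) h + contour_integral (linepath a3 a4) h
     + contour_integral (linepath a4 a1) h"
proof -
  have pr: "rectpath a1 a3 = linepath a1 a2 +++ linepath a2 a3 +++ linepath a3 a4 +++ linepath a4 a1"
    by (simp add: rectpath_def a2_def a4_def Let_def)
  then have "path_image (rectpath a1 a3) = closed_segment a1 a2 \<union> closed_segment a2 a3
      \<union> closed_segment a3 a4 \<union> closed_segment a4 a1"
    by (simp add: path_image_join Un_assoc)
  then have [simp]: "h contour_integrable_on linepath a1 a2" "h contour_integrable_on linepath a2 a3"
    "h contour_integrable_on linepath a3 a4" "h contour_integrable_on linepath a4 a1"
    by (auto intro!: contour_integrable_continuous_linepath continuous_on_subset[OF assms(1)])
  show ?thesis unfolding pr by (simp add: add.assoc)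
qed

section \<open>A Gaussian-damped Dirichlet kernel\<close>

text \<open>The function \<open>exp (- w\<^sup>2) * sin (R * w) / (pi * w)\<close>, made entire by its limit at 0.  Without the
  Gaussian it is the Dirichlet kernel that cuts off the frequencies beyond \<open>R\<close>; the Gaussian makes
  it decay along horizontal lines.\<close>

definition cutoff_kernel :: "real \<Rightarrow> complex \<Rightarrow> complex" where
  "cutoff_kernel R w = exp (- w\<^sup>2) * (if w = 0 then of_real R else sin (of_real R * w) / w) / of_real pi"

text \<open>The two exponentials of the sine, taken separately.  For large \<open>R\<close> this is small in the upper
  half-plane, with \<open>- R\<close> in the lower one; the price is a simple pole at 0.\<close>

definition half_kernel :: "real \<Rightarrow> complex \<Rightarrow> complex" where
  "half_kernel R w = exp (- w\<^sup>2) * exp (\<i> * of_real R * w) / (2 * of_real pi * \<i> * w)"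

lemma cutoff_kernel_eq_half_kernels:
  assumes "w \<noteq> 0"
  shows "cutoff_kernel R w = half_kernel R w - half_kernel (- R) w"
  using assms unfolding cutoff_kernel_def half_kernel_def sin_exp_eq
  by (simp add: field_simps)

lemma cutoff_kernel_holomorphic: "cutoff_kernel R holomorphic_on UNIV"
proof -
  let ?g = "\<lambda>w::complex. sin (of_real R * w)"
  have "(\<lambda>w::complex. if w = 0 then of_real R else ?g w / w) holomorphic_on UNIV"
  proof (rule pole_theorem_open_0)
    show "?g holomorphic_on UNIV" by (intro holomorphic_intros)
    have "deriv ?g 0 = of_real R"
      by (rule DERIV_imp_deriv) (auto intro!: derivative_eq_intros)
    then show "(if 0 = (0::complex) then of_real R else ?g 0 / 0) = deriv ?g 0" by simp
  qed auto
  then show ?thesis unfolding cutoff_kernel_def by (intro holomorphic_intros) auto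
qed

lemma norm_exp_minus_square: "norm (exp (- w\<^sup>2)) = exp ((Im w)\<^sup>2) * exp (- (Re w)\<^sup>2)" for w :: complex
  by (simp add: exp_add[symmetric] power2_eq_square)

text \<open>The factor \<open>norm w\<close> compensates for the denominator of the cutoff kernel at 0.  It comes from the
  mean value inequality on the strip, where the cosine is bounded by \<open>exp (R * \<bar>Im w\<bar>)\<close>.\<close>

lemma norm_sin_le_strip:
  fixes w :: complex
  assumes "0 \<le> R"
  shows "norm (sin (of_real R * w)) \<le> R * exp (R * \<bar>Im w\<bar>) * norm w"
proof -
  let ?S = "{u. Im u \<le> \<bar>Im w\<bar>} \<inter> {u. - \<bar>Im w\<bar> \<le> Im u}"
  have cos_le: "norm (cos u) \<le> exp \<bar>Im u\<bar>" for u :: complex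
  proof -
    have "norm (exp (\<i> * u) + exp (- (\<i> * u))) \<le> exp \<bar>Im u\<bar> + exp \<bar>Im u\<bar>"
      by (rule norm_triangle_le, rule add_mono) auto
    then show ?thesis by (simp add: cos_exp_eq norm_divide)
  qed
  have "norm (sin (of_real R * w) - sin (of_real R * 0)) \<le> R * exp (R * \<bar>Im w\<bar>) * norm (w - 0)"
  proof (rule field_differentiable_bound)
    show "convex ?S"
      by (intro convex_Int convex_halfspace_Im_le convex_halfspace_Im_ge)
    show "((\<lambda>u. sin (of_real R * u)) has_field_derivative of_real R * cos (of_real R * u))
        (at u within ?S)" for u
      by (auto intro!: derivative_eq_intros)
    fix u assume u: "u \<in> ?S"
    have "norm (cos (of_real R * u)) \<le> exp (R * \<bar>Im u\<bar>)"
      using cos_le[of "of_real R * u"] assms by (simp add: abs_mult)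
    also have "\<dots> \<le> exp (R * \<bar>Im w\<bar>)" using u assms by (auto intro!: mult_left_mono)
    finally show "norm (of_real R * cos (of_real R * u)) \<le> R * exp (R * \<bar>Im w\<bar>)"
      using assms by (simp add: norm_mult mult_left_mono)
  qed auto
  then show ?thesis by simp
qed

text \<open>The \<open>+ 1\<close> in the exponent accounts for the factor \<open>R \<le> exp R\<close> lost near \<open>w = 0\<close>.\<close>

lemma norm_cutoff_kernel_le:
  assumes "0 \<le> R" "\<bar>Im w\<bar> \<le> h"
  shows "norm (cutoff_kernel R w) \<le> exp (h\<^sup>2) * exp (R * (h + 1)) * exp (- (Re w)\<^sup>2)"
proof -
  have R: "R \<le> exp R" using exp_ge_add_one_self[of R] by linarith
  have sinc: "norm (if w = 0 then of_real R else sin (of_real R * w) / w) \<le> R * exp (R * \<bar>Im w\<bar>)"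
    using norm_sin_le_strip[OF assms(1), of w] assms(1) by (auto simp: norm_divide field_simps)
  also have "\<dots> \<le> exp R * exp (R * h)"
    using assms R by (intro mult_mono) (auto intro!: mult_left_mono)
  finally have s: "norm (if w = 0 then of_real R else sin (of_real R * w) / w) \<le> exp (R * (h + 1))"
    by (simp add: exp_add[symmetric] algebra_simps)
  have e: "norm (exp (- w\<^sup>2)) \<le> exp (h\<^sup>2) * exp (- (Re w)\<^sup>2)"
    unfolding norm_exp_minus_square using assms
    by (intro mult_right_mono) (auto simp: abs_le_square_iff[symmetric])
  have "norm (cutoff_kernel R w) \<le> (exp (h\<^sup>2) * exp (- (Re w)\<^sup>2)) * exp (R * (h + 1)) / pi"
    unfolding cutoff_kernel_def norm_divide norm_mult
    using mult_mono[OF e s] by (simp add: divide_right_mono)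
  also have "\<dots> \<le> (exp (h\<^sup>2) * exp (- (Re w)\<^sup>2)) * exp (R * (h + 1)) / 1"
    using pi_gt3 by (intro divide_left_mono) auto
  finally show ?thesis by (simp add: mult_ac)
qed

lemma norm_half_kernel_le:
  assumes "\<bar>Im w\<bar> \<le> h" "1 / 2 \<le> norm w"
  shows "norm (half_kernel R w) \<le> exp (h\<^sup>2) * exp (- (R * Im w)) * exp (- (Re w)\<^sup>2)"
proof -
  have e: "norm (exp (- w\<^sup>2)) \<le> exp (h\<^sup>2) * exp (- (Re w)\<^sup>2)"
    unfolding norm_exp_minus_square using assms
    by (intro mult_right_mono) (auto simp: abs_le_square_iff[symmetric])
  have w: "1 \<le> 2 * pi * norm w"
    using assms(2) pi_gt3 mult_mono[of 1 pi 1 "2 * norm w"] by simp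
  have "norm (half_kernel R w) = norm (exp (- w\<^sup>2)) * exp (- (R * Im w)) / (2 * pi * norm w)"
    by (simp add: half_kernel_def norm_divide norm_mult)
  also have "\<dots> \<le> norm (exp (- w\<^sup>2)) * exp (- (R * Im w)) / 1"
    using w by (intro divide_left_mono) auto
  also have "\<dots> \<le> (exp (h\<^sup>2) * exp (- (Re w)\<^sup>2)) * exp (- (R * Im w))"
    using e by (simp add: mult_right_mono)
  finally show ?thesis by (simp add: mult_ac)
qed

section \<open>Reproducing an entire function from its convolution\<close>

lemma continuous_convolution_integrand:
  assumes "f holomorphic_on UNIV"
  shows "continuous_on S (\<lambda>t. f t * cutoff_kernel R (z - t))"
proof -
  have "(\<lambda>t. f t * cutoff_kernel R (z - t)) holomorphic_on UNIV"
    by (intro holomorphic_on_mult assms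
        holomorphic_on_compose_gen[OF _ cutoff_kernel_holomorphic, unfolded o_def]
        holomorphic_intros) auto
  then show ?thesis using holomorphic_on_imp_continuous_on continuous_on_subset by blast
qed

lemma continuous_half_kernel_integrand:
  assumes "f holomorphic_on UNIV" "z \<notin> S"
  shows "continuous_on S (\<lambda>t. f t * half_kernel R (z - t))"
proof -
  have "continuous_on S f"
    using assms(1) holomorphic_on_imp_continuous_on continuous_on_subset by blast
  then show ?thesis
    unfolding half_kernel_def using assms(2) by (intro continuous_intros) auto
qed

text \<open>The entire integrand is moved from the real line to the lower edge of a rectangle and split there
  as \<open>half_kernel R - half_kernel (- R)\<close>.  The first half is small on the lower edge and stays.  The
  second half is small on the upper edge and is moved there, across its pole at \<open>t = z\<close>; the residue there
  contributes \<open>f z\<close>.  Formally, Cauchy's theorem is applied to the entire integrand on the lower half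
  \<open>A B F E\<close> of the rectangle, and Cauchy's integral formula to the second half-kernel on the whole
  rectangle \<open>A B C D\<close>, so that no path meets the pole.\<close>

lemma cutoff_reproduction:
  fixes R :: real
  assumes f: "f holomorphic_on UNIV" and z: "\<bar>Im z\<bar> < c" "\<bar>Re z\<bar> < M"
  defines "A \<equiv> Complex (- M) (- c)" and "B \<equiv> Complex M (- c)" and "C \<equiv> Complex M c"
    and "D \<equiv> Complex (- M) c" and "E \<equiv> Complex (- M) 0" and "F \<equiv> Complex M 0"
    and "k \<equiv> \<lambda>t. f t * cutoff_kernel R (z - t)" and "kp \<equiv> \<lambda>t. f t * half_kernel R (z - t)"
    and "km \<equiv> \<lambda>t. f t * half_kernel (- R) (z - t)"
  shows "f z - contour_integral (linepath E F) k =
     - contour_integral (linepath A B) kp - contour_integral (linepath C D) km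
     - (contour_integral (linepath B C) km + contour_integral (linepath D A) km)
     - (contour_integral (linepath B F) k + contour_integral (linepath E A) k)"
proof -
  have c: "0 < c" and M: "0 < M" using z by auto
  have hk: "k holomorphic_on UNIV"
    unfolding k_def
    by (intro holomorphic_on_mult f holomorphic_on_compose_gen[OF _ cutoff_kernel_holomorphic, unfolded o_def]
        holomorphic_intros) auto
  have ck: "continuous_on S k" for S
    unfolding k_def by (rule continuous_convolution_integrand[OF f])
  note chalf = continuous_half_kernel_integrand[OF f]
  have lower: "contour_integral (linepath A B) k + contour_integral (linepath B F) k
     + contour_integral (linepath F E) k + contour_integral (linepath E A) k = 0"
  proof -
    have "(k has_contour_integral 0) (rectpath A F)"
      by (rule Cauchy_theorem_convex_simple[OF hk]) auto
    then show ?thesis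
      using contour_integral_rectpath_sides[of A F k, OF ck] c M
      by (simp add: A_def F_def B_def E_def contour_integral_unique)
  qed
  have zin: "z \<in> box A C" using z by (auto simp: in_box_complex_iff A_def C_def)
  have zout: "z \<notin> path_image (rectpath A C)"
    using z c M by (auto simp: path_image_rectpath A_def C_def)
  have full: "contour_integral (linepath A B) km + contour_integral (linepath B C) km
     + contour_integral (linepath C D) km + contour_integral (linepath D A) km = - f z"
  proof -
    \<comment> \<open>the sign comes from \<open>z - t = - (t - z)\<close>\<close>
    let ?h = "\<lambda>t. - f t * (exp (- (z - t)\<^sup>2) * exp (\<i> * of_real (- R) * (z - t))) / (2 * of_real pi * \<i>)"
    have "((\<lambda>t. ?h t / (t - z)) has_contour_integral
        (2 * pi * \<i> * winding_number (rectpath A C) z * ?h z)) (rectpath A C)"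
    proof (rule Cauchy_integral_formula_convex_simple[of UNIV])
      show "?h holomorphic_on UNIV" by (intro holomorphic_intros f) auto
    qed (use zout in auto)
    moreover have "(\<lambda>t. ?h t / (t - z)) = km"
    proof
      fix t
      show "?h t / (t - z) = km t"
        by (cases "t = z") (auto simp: km_def half_kernel_def divide_simps, auto simp: algebra_simps)
    qed
    ultimately have "(km has_contour_integral - f z) (rectpath A C)"
      using winding_number_rectpath[OF zin] by simp
    then show ?thesis
      using contour_integral_rectpath_sides[of A C km] chalf[OF zout, of "- R"] c M
      by (simp add: A_def B_def C_def D_def km_def contour_integral_unique)
  qed
  have zAB: "z \<notin> closed_segment A B"
    using z by (auto simp: A_def B_def closed_segment_same_Im)
  have "contour_integral (linepath A B) k = contour_integral (linepath A B) (\<lambda>t. kp t - km t)"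
  proof (rule contour_integral_eq)
    fix t assume "t \<in> path_image (linepath A B)"
    then have "z - t \<noteq> 0" using zAB by auto
    then show "k t = kp t - km t"
      by (simp add: k_def kp_def km_def cutoff_kernel_eq_half_kernels right_diff_distrib)
  qed
  also have "\<dots> = contour_integral (linepath A B) kp - contour_integral (linepath A B) km"
    unfolding kp_def km_def
    by (intro contour_integral_diff contour_integrable_continuous_linepath chalf zAB)
  finally have AB: "contour_integral (linepath A B) k
    = contour_integral (linepath A B) kp - contour_integral (linepath A B) km" .
  have "contour_integral (linepath F E) k = - contour_integral (linepath E F) k"
    by (rule contour_integral_reverse_linepath[OF ck])
  with lower full AB show ?thesis by (simp add: algebra_simps) algebra
qed

definition truncated_convolution ::
    "real \<Rightarrow> real \<Rightarrow> (complex \<Rightarrow> complex) \<Rightarrow> complex \<Rightarrow> complex" where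
  "truncated_convolution R T f z =
     contour_integral (linepath (Complex (- T) 0) (Complex T 0)) (\<lambda>t. f t * cutoff_kernel R (z - t))"

lemma truncated_convolution_holomorphic:
  assumes f: "f holomorphic_on UNIV"
  shows "truncated_convolution R T f holomorphic_on UNIV"
proof -
  let ?l = "linepath (Complex (- T) 0) (Complex T 0)"
  let ?d = "Complex T 0 - Complex (- T) 0"
  let ?g = "\<lambda>z s. f (?l s) * cutoff_kernel R (z - ?l s) * ?d"
  have K: "cutoff_kernel R holomorphic_on UNIV" by (rule cutoff_kernel_holomorphic)
  have cK: "continuous_on UNIV (cutoff_kernel R)" and cK': "continuous_on UNIV (deriv (cutoff_kernel R))"
    and cf: "continuous_on UNIV f"
    using K holomorphic_deriv[OF K] f by (auto intro: holomorphic_on_imp_continuous_on)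
  have dK: "(cutoff_kernel R has_field_derivative deriv (cutoff_kernel R) w) (at w)" for w
    using holomorphic_derivI[OF K, of w] by simp
  have "(\<lambda>z. integral (cbox 0 1) (?g z)) holomorphic_on UNIV"
  proof (rule leibniz_rule_holomorphic)
    show "((\<lambda>z. ?g z s) has_field_derivative f (?l s) * deriv (cutoff_kernel R) (z - ?l s) * ?d)
        (at z within UNIV)" for z s
      by (auto intro!: derivative_eq_intros DERIV_chain2[OF dK])
    show "?g z integrable_on cbox 0 1" for z
      by (intro integrable_continuous continuous_intros continuous_on_compose2[OF cf]
          continuous_on_compose2[OF cK] continuous_on_linepath) auto
    show "continuous_on (UNIV \<times> cbox 0 1) (\<lambda>(z, s). f (?l s) * deriv (cutoff_kernel R) (z - ?l s) * ?d)"
      unfolding case_prod_unfold linepath_def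
      by (intro continuous_intros continuous_on_compose2[OF cf] continuous_on_compose2[OF cK']) auto
  qed auto
  moreover have "integral (cbox 0 1) (?g z) = truncated_convolution R T f z" for z
  proof -
    have "((\<lambda>t. f t * cutoff_kernel R (z - t)) has_contour_integral truncated_convolution R T f z) ?l"
      unfolding truncated_convolution_def
      by (intro has_contour_integral_integral contour_integrable_continuous_linepath
          continuous_convolution_integrand f)
    then show ?thesis unfolding has_contour_integral_linepath by (simp only: cbox_interval integral_unique)
  qed
  ultimately show ?thesis by (simp cong: holomorphic_cong)
qed

section \<open>Weighted estimates for the convolution\<close>

text \<open>Used with \<open>g = f t\<close> and \<open>\<kappa>\<close> a kernel at \<open>z - t\<close>.  The bound has the weight at \<open>z\<close>, and depends on \<open>t\<close>
  in the form required for integration along a horizontal line.\<close>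

lemma weighted_product_le:
  fixes g \<kappa> :: complex
  assumes \<gamma>: "0 < \<gamma>" "\<gamma> \<le> 1" and "0 \<le> A" "0 \<le> P"
    and "norm g \<le> A * exp (- (b * \<bar>Re t\<bar> powr \<gamma>))"
    and "norm \<kappa> \<le> P * exp (- (Re (z - t))\<^sup>2)"
  shows "norm (g * \<kappa>) \<le> A * P * transfer_const b * exp (- (b * \<bar>Re z\<bar> powr \<gamma>)) / (1 + (Re t - Re z)\<^sup>2)"
proof -
  have "norm (g * \<kappa>) \<le> (A * exp (- (b * \<bar>Re t\<bar> powr \<gamma>))) * (P * exp (- (Re (z - t))\<^sup>2))"
    unfolding norm_mult by (rule mult_mono[OF assms(5,6)]) (use assms(3) in auto)
  also have "\<dots> = A * P * (exp (- (b * \<bar>Re t\<bar> powr \<gamma>)) * exp (- (Re z - Re t)\<^sup>2))"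
    by (simp only: minus_complex.sel mult_ac)
  also have "\<dots> \<le> A * P * (transfer_const b * exp (- (b * \<bar>Re z\<bar> powr \<gamma>)) / (1 + (Re t - Re z)\<^sup>2))"
    using assms(3,4) by (intro mult_left_mono gauss_transfers_weight[OF \<gamma>]) auto
  finally show ?thesis by (simp add: mult.assoc)
qed

text \<open>In the reproduction formula on the rectangle of half-height \<open>p + 1 / 2\<close>, the horizontal edges stay
  at distance at least \<open>1 / 2\<close> from the strip \<open>\<bar>Im z\<bar> \<le> p\<close>, which makes the half-kernels of size
  \<open>exp (- R / 2)\<close> there.  The four vertical pieces, at distance at least 1 from \<open>z\<close>,
  produce the second term, which vanishes as the window grows.\<close>

lemma convolution_error_finite_window:
  fixes R p b \<gamma> M :: real
  assumes \<gamma>: "0 < \<gamma>" "\<gamma> \<le> 1" and f: "f holomorphic_on UNIV" and "0 \<le> p" "0 \<le> R"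
    and fb: "\<And>t. \<bar>Im t\<bar> \<le> p + 1 / 2 \<Longrightarrow> norm (f t) \<le> exp (- (b * \<bar>Re t\<bar> powr \<gamma>))"
    and z: "\<bar>Im z\<bar> \<le> p" and M: "\<bar>Re z\<bar> + 1 \<le> M"
  defines "W \<equiv> transfer_const b * exp ((2 * p + 1)\<^sup>2) * exp (- (b * \<bar>Re z\<bar> powr \<gamma>))"
  shows "norm (f z - truncated_convolution R M f z)
    \<le> 2 * pi * W * exp (- R / 2) + 8 * (p + 1 / 2) * W * exp (R * (2 * p + 2)) / (1 + (M - \<bar>Re z\<bar>)\<^sup>2)"
proof -
  define c where "c = p + 1 / 2"
  define h where "h = 2 * p + 1"
  define k where "k = (\<lambda>t. f t * cutoff_kernel R (z - t))"
  define kp where "kp = (\<lambda>t. f t * half_kernel R (z - t))"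
  define km where "km = (\<lambda>t. f t * half_kernel (- R) (z - t))"
  define B where "B = W * exp (R * (2 * p + 2)) / (1 + (M - \<bar>Re z\<bar>)\<^sup>2)"
  have W: "0 < W" by (simp add: W_def transfer_const_pos)
  have B: "0 \<le> B" using W by (auto simp: B_def intro!: divide_nonneg_pos add_pos_nonneg)
  have fc: "norm (f t) \<le> 1 * exp (- (b * \<bar>Re t\<bar> powr \<gamma>))" if "\<bar>Im t\<bar> \<le> c" for t
    using fb[of t] that by (simp add: c_def)
  have Im_le: "\<bar>Im (z - t)\<bar> \<le> h" if "\<bar>Im t\<bar> \<le> c" for t
    using z that by (auto simp: c_def h_def)
  have half: "norm (f t * half_kernel S (z - t)) \<le> W * E / (1 + (Re t - Re z)\<^sup>2)"
    if "\<bar>Im t\<bar> \<le> c" "1 / 2 \<le> norm (z - t)" "exp (- (S * Im (z - t))) \<le> E" for t S E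
  proof -
    have "norm (half_kernel S (z - t)) \<le> (exp (h\<^sup>2) * E) * exp (- (Re (z - t))\<^sup>2)"
      using norm_half_kernel_le[OF Im_le that(2), of S] that(1,3)
      by (smt (verit) exp_ge_zero mult_left_mono mult_right_mono)
    moreover have "0 \<le> E" using that(3) by (smt (verit) exp_gt_zero)
    ultimately have "norm (f t * half_kernel S (z - t))
        \<le> 1 * (exp (h\<^sup>2) * E) * transfer_const b * exp (- (b * \<bar>Re z\<bar> powr \<gamma>)) / (1 + (Re t - Re z)\<^sup>2)"
      using fc[OF that(1)] by (intro weighted_product_le[OF \<gamma>]) auto
    then show ?thesis by (simp add: W_def h_def mult_ac)
  qed
  have full: "norm (k t) \<le> W * exp (R * (2 * p + 2)) / (1 + (Re t - Re z)\<^sup>2)" if "\<bar>Im t\<bar> \<le> c" for t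
  proof -
    have "norm (f t * cutoff_kernel R (z - t))
        \<le> 1 * (exp (h\<^sup>2) * exp (R * (h + 1))) * transfer_const b * exp (- (b * \<bar>Re z\<bar> powr \<gamma>))
          / (1 + (Re t - Re z)\<^sup>2)"
      using fc[OF that] by (intro weighted_product_le[OF \<gamma>] norm_cutoff_kernel_le Im_le that \<open>0 \<le> R\<close>) auto
    then show ?thesis by (simp add: W_def h_def k_def mult_ac add_ac)
  qed
  have side: "W * exp (R * (2 * p + 2)) / (1 + (Re t - Re z)\<^sup>2) \<le> B" if "\<bar>Re t\<bar> = M" for t
  proof -
    have "(M - \<bar>Re z\<bar>)\<^sup>2 \<le> (Re t - Re z)\<^sup>2"
      using M that by (intro abs_le_square_iff[THEN iffD1]) auto
    then show ?thesis
      unfolding B_def using W by (intro divide_left_mono) (auto intro!: mult_pos_pos add_pos_nonneg)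
  qed
  have k_side: "norm (k t) \<le> B" if "\<bar>Re t\<bar> = M" "\<bar>Im t\<bar> \<le> c" for t
    using full[of t] side[of t] that by linarith
  have km_side: "norm (km t) \<le> B" if "\<bar>Re t\<bar> = M" "\<bar>Im t\<bar> \<le> c" for t
  proof -
    have "1 / 2 \<le> norm (z - t)" using M that abs_Re_le_cmod[of "z - t"] by auto
    moreover have "exp (- (- R * Im (z - t))) \<le> exp (R * (2 * p + 2))"
      using Im_le[OF that(2)] \<open>0 \<le> R\<close> \<open>0 \<le> p\<close> unfolding h_def
      by (simp add: mult_left_mono del: minus_complex.sel)
    ultimately show ?thesis using half[of t "- R" "exp (R * (2 * p + 2))"] side[of t] that
      by (simp add: km_def)
  qed
  have cont_k: "continuous_on S k" for S
    unfolding k_def by (rule continuous_convolution_integrand[OF f])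
  note cont_half = continuous_half_kernel_integrand[OF f]
  have z_off_horizontal: "z \<notin> closed_segment (Complex x1 y) (Complex x2 y)" if "\<bar>y\<bar> = c" for x1 x2 y
    using that z by (auto simp: closed_segment_same_Im c_def)
  have z_off_vertical: "z \<notin> closed_segment (Complex x y1) (Complex x y2)" if "\<bar>x\<bar> = M" for x y1 y2
    using that M by (auto simp: closed_segment_same_Re)
  have bottom: "norm (contour_integral (linepath (Complex (- M) (- c)) (Complex M (- c))) kp)
      \<le> (W * exp (- R / 2)) * pi"
  proof (rule norm_contour_integral_horizontal_le[where x = "Re z"])
    fix s
    have "1 / 2 \<le> Im (z - Complex s (- c))" using z by (simp add: c_def)
    moreover from this have "exp (- (R * Im (z - Complex s (- c)))) \<le> exp (- R / 2)"
      using \<open>0 \<le> R\<close> mult_left_mono[of "1 / 2" "Im (z - Complex s (- c))" R] by simp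
    ultimately show "norm (kp (Complex s (- c))) \<le> W * exp (- R / 2) / (1 + (s - Re z)\<^sup>2)"
      using half[of "Complex s (- c)" R "exp (- R / 2)"] abs_Im_le_cmod[of "z - Complex s (- c)"] \<open>0 \<le> p\<close>
      by (simp add: kp_def c_def)
  qed (use W M in \<open>auto simp: kp_def intro!: cont_half z_off_horizontal, auto simp: c_def \<open>0 \<le> p\<close>\<close>)
  have "norm (contour_integral (linepath (Complex (- M) c) (Complex M c)) km)
      \<le> (W * exp (- R / 2)) * pi"
  proof (rule norm_contour_integral_horizontal_le[where x = "Re z"])
    fix s
    have "1 / 2 \<le> - Im (z - Complex s c)" using z by (simp add: c_def)
    moreover from this have "exp (- (- R * Im (z - Complex s c))) \<le> exp (- R / 2)"
      using \<open>0 \<le> R\<close> mult_left_mono[of "1 / 2" "- Im (z - Complex s c)" R] by (simp add: algebra_simps)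
    ultimately show "norm (km (Complex s c)) \<le> W * exp (- R / 2) / (1 + (s - Re z)\<^sup>2)"
      using half[of "Complex s c" "- R" "exp (- R / 2)"] abs_Im_le_cmod[of "z - Complex s c"] \<open>0 \<le> p\<close>
      by (simp add: km_def c_def)
  qed (use W M in \<open>auto simp: km_def intro!: cont_half z_off_horizontal, auto simp: c_def \<open>0 \<le> p\<close>\<close>)
  moreover have "contour_integral (linepath (Complex M c) (Complex (- M) c)) km
      = - contour_integral (linepath (Complex (- M) c) (Complex M c)) km"
    unfolding km_def using \<open>0 \<le> p\<close>
    by (intro contour_integral_reverse_linepath cont_half z_off_horizontal) (simp add: c_def)
  ultimately have top: "norm (contour_integral (linepath (Complex M c) (Complex (- M) c)) km)
      \<le> (W * exp (- R / 2)) * pi"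
    by simp
  have c0: "0 \<le> c" and M0: "0 \<le> M" using \<open>0 \<le> p\<close> M by (auto simp: c_def)
  have sides:
    "norm (contour_integral (linepath (Complex M (- c)) (Complex M c)) km) \<le> 2 * c * B"
    "norm (contour_integral (linepath (Complex (- M) c) (Complex (- M) (- c))) km) \<le> 2 * c * B"
    "norm (contour_integral (linepath (Complex M (- c)) (Complex M 0)) k) \<le> 2 * c * B"
    "norm (contour_integral (linepath (Complex (- M) 0) (Complex (- M) (- c))) k) \<le> 2 * c * B"
    using c0 M0 B unfolding km_def
    by (intro norm_contour_integral_vertical_le km_side[unfolded km_def] k_side cont_k cont_half
        z_off_vertical; simp)+
  have tri: "norm (- u1 - u2 - (u3 + u4) - (u5 + u6))
      \<le> norm u1 + norm u2 + (norm u3 + norm u4) + (norm u5 + norm u6)" for u1 u2 u3 u4 u5 u6 :: complex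
    using norm_triangle_ineq4[of "- u1 - u2 - (u3 + u4)" "u5 + u6"]
      norm_triangle_ineq4[of "- u1 - u2" "u3 + u4"] norm_triangle_ineq4[of "- u1" u2]
      norm_triangle_ineq[of u3 u4] norm_triangle_ineq[of u5 u6] by simp
  have "\<bar>Im z\<bar> < c" "\<bar>Re z\<bar> < M" using z M by (auto simp: c_def)
  from cutoff_reproduction[OF f this, of R]
  have "norm (f z - truncated_convolution R M f z) \<le> (W * exp (- R / 2)) * pi + (W * exp (- R / 2)) * pi
      + (2 * c * B + 2 * c * B) + (2 * c * B + 2 * c * B)"
    unfolding truncated_convolution_def k_def[symmetric] kp_def[symmetric] km_def[symmetric]
    using tri bottom top sides by (smt (verit))
  then show ?thesis by (simp add: c_def B_def algebra_simps)
qed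

text \<open>On the window \<open>\<bar>t\<bar> \<le> T\<close> the weights with parameters \<open>b\<close> and \<open>d\<close> differ at most by the factor
  \<open>exp (\<bar>d - b\<bar> * T powr \<gamma>)\<close>.  Truncation thus gives the convolution any prescribed decay.\<close>

lemma truncated_convolution_le:
  fixes R T b d h \<gamma> :: real
  assumes \<gamma>: "0 < \<gamma>" "\<gamma> \<le> 1" and f: "f holomorphic_on UNIV" and "0 \<le> T" "0 \<le> R"
    and fb: "\<And>t. Im t = 0 \<Longrightarrow> norm (f t) \<le> exp (- (b * \<bar>Re t\<bar> powr \<gamma>))"
    and z: "\<bar>Im z\<bar> \<le> h"
  shows "norm (truncated_convolution R T f z) \<le> pi * transfer_const d * exp (h\<^sup>2)
    * exp (R * (h + 1) + \<bar>d - b\<bar> * T powr \<gamma>) * exp (- (d * \<bar>Re z\<bar> powr \<gamma>))"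
proof -
  let ?A = "exp (\<bar>d - b\<bar> * T powr \<gamma>)"
  let ?D = "?A * (exp (h\<^sup>2) * exp (R * (h + 1))) * transfer_const d * exp (- (d * \<bar>Re z\<bar> powr \<gamma>))"
  have "norm (truncated_convolution R T f z) \<le> ?D * pi"
    unfolding truncated_convolution_def
  proof (rule norm_contour_integral_horizontal_le[where x = "Re z"])
    fix s assume s: "- T \<le> s" "s \<le> T"
    have "(d - b) * \<bar>s\<bar> powr \<gamma> \<le> \<bar>d - b\<bar> * T powr \<gamma>"
      using s \<gamma> by (intro mult_mono powr_mono2) auto
    then have "exp (- (b * \<bar>s\<bar> powr \<gamma>)) \<le> ?A * exp (- (d * \<bar>s\<bar> powr \<gamma>))"
      unfolding exp_add[symmetric] by (simp add: algebra_simps)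
    then have "norm (f (Complex s 0)) \<le> ?A * exp (- (d * \<bar>Re (Complex s 0)\<bar> powr \<gamma>))"
      using fb[of "Complex s 0"] by simp
    then have "norm (f (Complex s 0) * cutoff_kernel R (z - Complex s 0)) \<le> ?D / (1 + (Re (Complex s 0) - Re z)\<^sup>2)"
      using z \<open>0 \<le> R\<close> by (intro weighted_product_le[OF \<gamma>] norm_cutoff_kernel_le) auto
    then show "norm (f (Complex s 0) * cutoff_kernel R (z - Complex s 0)) \<le> ?D / (1 + (s - Re z)\<^sup>2)"
      by simp
  qed (use \<open>0 \<le> T\<close> transfer_const_pos[of d] in \<open>auto intro: continuous_convolution_integrand f\<close>)
  then show ?thesis by (simp add: exp_add mult_ac)
qed

text \<open>Outside the window, passing from the weight parameter \<open>b\<close> to the smaller \<open>a\<close> gains the factor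
  \<open>exp (- (b - a) * T powr \<gamma>)\<close>, which can be made to beat the growth \<open>exp (R * (p + 1))\<close> of the kernel.\<close>

lemma truncated_convolution_tail_le:
  fixes R T M a b p \<gamma> :: real
  assumes \<gamma>: "0 < \<gamma>" "\<gamma> \<le> 1" and f: "f holomorphic_on UNIV" and "0 \<le> R" "0 \<le> T" "T \<le> M" "a \<le> b"
    and fb: "\<And>t. Im t = 0 \<Longrightarrow> norm (f t) \<le> exp (- (b * \<bar>Re t\<bar> powr \<gamma>))"
    and z: "\<bar>Im z\<bar> \<le> p"
  shows "norm (truncated_convolution R M f z - truncated_convolution R T f z)
    \<le> 2 * pi * transfer_const a * exp (p\<^sup>2) * exp (R * (p + 1) - (b - a) * T powr \<gamma>)
      * exp (- (a * \<bar>Re z\<bar> powr \<gamma>))"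
proof -
  let ?k = "\<lambda>t. f t * cutoff_kernel R (z - t)"
  let ?I = "\<lambda>x y. contour_integral (linepath (Complex x 0) (Complex y 0)) ?k"
  let ?A = "exp (- ((b - a) * T powr \<gamma>))"
  let ?D = "?A * (exp (p\<^sup>2) * exp (R * (p + 1))) * transfer_const a * exp (- (a * \<bar>Re z\<bar> powr \<gamma>))"
  have cont: "continuous_on S ?k" for S by (rule continuous_convolution_integrand[OF f])
  have split: "?I x y = ?I x m + ?I m y" if "x \<le> m" "m \<le> y" for x m y
    using that by (intro contour_integral_split_linepath cont)
      (auto simp: closed_segment_same_Im closed_segment_eq_real_ivl)
  have tail: "norm (?I x y) \<le> ?D * pi" if "x \<le> y" "\<And>s. x \<le> s \<Longrightarrow> s \<le> y \<Longrightarrow> T \<le> \<bar>s\<bar>" for x y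
  proof (rule norm_contour_integral_horizontal_le[where x = "Re z"])
    fix s assume s: "x \<le> s" "s \<le> y"
    have "(b - a) * T powr \<gamma> \<le> (b - a) * \<bar>s\<bar> powr \<gamma>"
      using that(2)[OF s] \<open>0 \<le> T\<close> \<open>a \<le> b\<close> \<gamma> by (intro mult_left_mono powr_mono2) auto
    then have "exp (- (b * \<bar>s\<bar> powr \<gamma>)) \<le> ?A * exp (- (a * \<bar>s\<bar> powr \<gamma>))"
      unfolding exp_add[symmetric] by (simp add: algebra_simps)
    then have "norm (f (Complex s 0)) \<le> ?A * exp (- (a * \<bar>Re (Complex s 0)\<bar> powr \<gamma>))"
      using fb[of "Complex s 0"] by simp
    then have "norm (?k (Complex s 0)) \<le> ?D / (1 + (Re (Complex s 0) - Re z)\<^sup>2)"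
      using z \<open>0 \<le> R\<close> by (intro weighted_product_le[OF \<gamma>] norm_cutoff_kernel_le) auto
    then show "norm (?k (Complex s 0)) \<le> ?D / (1 + (s - Re z)\<^sup>2)" by simp
  qed (use that transfer_const_pos[of a] in \<open>auto intro: cont\<close>)
  have "truncated_convolution R M f z - truncated_convolution R T f z = ?I (- M) (- T) + ?I T M"
    using split[of "- M" "- T" M] split[of "- T" T M] \<open>0 \<le> T\<close> \<open>T \<le> M\<close>
    by (simp add: truncated_convolution_def)
  also have "norm \<dots> \<le> ?D * pi + ?D * pi"
    using \<open>0 \<le> T\<close> \<open>T \<le> M\<close> by (intro order_trans[OF norm_triangle_ineq] add_mono tail) auto
  also have "\<dots> = 2 * pi * transfer_const a * exp (p\<^sup>2) * exp (R * (p + 1) - (b - a) * T powr \<gamma>)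
      * exp (- (a * \<bar>Re z\<bar> powr \<gamma>))"
    by (simp add: exp_add[of "R * (p + 1)" "- ((b - a) * T powr \<gamma>)", simplified] mult_ac)
  finally show ?thesis .
qed

text \<open>The window of half-length \<open>M\<close> in the reproduction formula is sent to infinity, while the window
  of the convolution itself stays at \<open>T\<close>.\<close>

lemma truncated_convolution_error_le:
  fixes R T a b p \<gamma> :: real
  assumes \<gamma>: "0 < \<gamma>" "\<gamma> \<le> 1" and f: "f holomorphic_on UNIV" and "0 \<le> p" "0 \<le> R" "0 \<le> T" "a \<le> b"
    and fb: "\<And>t. \<bar>Im t\<bar> \<le> p + 1 / 2 \<Longrightarrow> norm (f t) \<le> exp (- (b * \<bar>Re t\<bar> powr \<gamma>))"
    and z: "\<bar>Im z\<bar> \<le> p"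
  shows "norm (f z - truncated_convolution R T f z)
    \<le> (2 * pi * transfer_const b * exp ((2 * p + 1)\<^sup>2) * exp (- R / 2)
       + 2 * pi * transfer_const a * exp (p\<^sup>2) * exp (R * (p + 1) - (b - a) * T powr \<gamma>))
      * exp (- (a * \<bar>Re z\<bar> powr \<gamma>))"
    (is "_ \<le> (?P + ?Q) * ?w")
proof (rule tendsto_lowerbound)
  define N where "N = 8 * (p + 1 / 2) * (transfer_const b * exp ((2 * p + 1)\<^sup>2)
    * exp (- (b * \<bar>Re z\<bar> powr \<gamma>))) * exp (R * (2 * p + 2))"
  have "((\<lambda>M. N / (1 + (M - \<bar>Re z\<bar>)\<^sup>2)) \<longlongrightarrow> 0) at_top" by real_asymp
  then show "((\<lambda>M. (?P + ?Q) * ?w + N / (1 + (M - \<bar>Re z\<bar>)\<^sup>2)) \<longlongrightarrow> (?P + ?Q) * ?w) at_top"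
    by (auto intro: tendsto_eq_intros)
  show "\<forall>\<^sub>F M in at_top. norm (f z - truncated_convolution R T f z)
      \<le> (?P + ?Q) * ?w + N / (1 + (M - \<bar>Re z\<bar>)\<^sup>2)"
    using eventually_ge_at_top[of "max T (\<bar>Re z\<bar> + 1)"]
  proof eventually_elim
    case (elim M)
    have "exp (- (b * \<bar>Re z\<bar> powr \<gamma>)) \<le> ?w" using \<open>a \<le> b\<close> by (simp add: mult_right_mono)
    then have "?P * exp (- (b * \<bar>Re z\<bar> powr \<gamma>)) \<le> ?P * ?w"
      using transfer_const_pos[of b] by (intro mult_left_mono) auto
    moreover have "norm (f z - truncated_convolution R M f z)
        \<le> ?P * exp (- (b * \<bar>Re z\<bar> powr \<gamma>)) + N / (1 + (M - \<bar>Re z\<bar>)\<^sup>2)"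
      using convolution_error_finite_window[OF \<gamma> f \<open>0 \<le> p\<close> \<open>0 \<le> R\<close> fb z, of M] elim
      by (simp add: N_def mult_ac)
    moreover have "norm (truncated_convolution R M f z - truncated_convolution R T f z) \<le> ?Q * ?w"
      using elim fb \<open>0 \<le> p\<close>
      by (intro truncated_convolution_tail_le[OF \<gamma> f \<open>0 \<le> R\<close> \<open>0 \<le> T\<close> _ \<open>a \<le> b\<close> _ z]) auto
    moreover have "norm (f z - truncated_convolution R T f z) \<le> norm (f z - truncated_convolution R M f z)
        + norm (truncated_convolution R M f z - truncated_convolution R T f z)"
      using norm_triangle_ineq[of "f z - truncated_convolution R M f z"
          "truncated_convolution R M f z - truncated_convolution R T f z"] by simp
    ultimately show ?case unfolding distrib_right by linarith
  qed
qed simp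

section \<open>Decomposition of the unit ball\<close>

text \<open>With \<open>l = ln (D * r)\<close>, the choice \<open>R = 2 * l\<close> and \<open>(b - a) * T powr \<gamma> = (2 * p + 3) * l\<close> turns both
  error terms into multiples of \<open>exp (- l) = 1 / (D * r)\<close>, and \<open>D\<close> exceeds the sum of their
  constants.  Every bound on the convolution is then a multiple of a fixed power of \<open>D * r\<close>.
  The constant \<open>D\<close> does not depend on the target strip \<open>h\<close> and weight \<open>d\<close>, so one function \<open>u\<close>
  serves all of them; this is what puts \<open>u\<close> into the function space.\<close>

lemma weighted_strip_decomposition:
  fixes a b p \<gamma> :: real
  assumes \<gamma>: "0 < \<gamma>" "\<gamma> \<le> 1" and "0 \<le> p" "a < b"
  obtains D where "1 \<le> D"
    and "\<And>f r. f holomorphic_on UNIV \<Longrightarrow> 1 \<le> r \<Longrightarrow>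
      (\<And>t. \<bar>Im t\<bar> \<le> p + 1 / 2 \<Longrightarrow> norm (f t) \<le> exp (- (b * \<bar>Re t\<bar> powr \<gamma>))) \<Longrightarrow>
      \<exists>u. u holomorphic_on UNIV
        \<and> (\<forall>z. \<bar>Im z\<bar> \<le> p \<longrightarrow> norm (f z - u z) \<le> 1 / r * exp (- (a * \<bar>Re z\<bar> powr \<gamma>)))
        \<and> (\<forall>h d z. \<bar>Im z\<bar> \<le> h \<longrightarrow> norm (u z) \<le> pi * transfer_const d * exp (h\<^sup>2)
             * (D * r) powr (2 * (h + 1) + \<bar>d - b\<bar> * (2 * p + 3) / (b - a))
             * exp (- (d * \<bar>Re z\<bar> powr \<gamma>)))"
proof
  let ?D1 = "2 * pi * transfer_const b * exp ((2 * p + 1)\<^sup>2)"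
  let ?D2 = "2 * pi * transfer_const a * exp (p\<^sup>2)"
  define D where "D = 1 + ?D1 + ?D2"
  have D1: "0 < ?D1" "0 < ?D2" by (auto simp: transfer_const_pos)
  then show "1 \<le> D" by (simp add: D_def)
  fix f :: "complex \<Rightarrow> complex" and r :: real
  assume f: "f holomorphic_on UNIV" and r: "1 \<le> r"
    and fb: "\<And>t. \<bar>Im t\<bar> \<le> p + 1 / 2 \<Longrightarrow> norm (f t) \<le> exp (- (b * \<bar>Re t\<bar> powr \<gamma>))"
  define l where "l = ln (D * r)"
  \<comment> \<open>the solution of \<open>R / 2 = l\<close> and \<open>(b - a) * T powr \<gamma> - R * (p + 1) = l\<close>\<close>
  define R where "R = 2 * l"
  define T where "T = ((2 * p + 3) * l / (b - a)) powr (1 / \<gamma>)"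
  have Dr: "1 \<le> D * r" using mult_mono[of 1 D 1 r] \<open>1 \<le> D\<close> r by simp
  have l: "0 \<le> l" "exp l = D * r" using Dr by (auto simp: l_def)
  have R: "0 \<le> R" and T: "0 \<le> T" using l by (auto simp: R_def T_def)
  have T\<gamma>: "T powr \<gamma> = (2 * p + 3) * l / (b - a)"
    using \<gamma> l \<open>0 \<le> p\<close> \<open>a < b\<close> by (simp add: T_def powr_powr)
  let ?u = "truncated_convolution R T f"
  show "\<exists>u. u holomorphic_on UNIV
        \<and> (\<forall>z. \<bar>Im z\<bar> \<le> p \<longrightarrow> norm (f z - u z) \<le> 1 / r * exp (- (a * \<bar>Re z\<bar> powr \<gamma>)))
        \<and> (\<forall>h d z. \<bar>Im z\<bar> \<le> h \<longrightarrow> norm (u z) \<le> pi * transfer_const d * exp (h\<^sup>2)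
             * (D * r) powr (2 * (h + 1) + \<bar>d - b\<bar> * (2 * p + 3) / (b - a))
             * exp (- (d * \<bar>Re z\<bar> powr \<gamma>)))"
  proof (intro exI[of _ ?u] conjI allI impI)
    show "?u holomorphic_on UNIV" by (rule truncated_convolution_holomorphic[OF f])
  next
    fix z :: complex assume z: "\<bar>Im z\<bar> \<le> p"
    have "(b - a) * T powr \<gamma> = (2 * p + 3) * l" using \<open>a < b\<close> by (simp add: T\<gamma>)
    then have "R * (p + 1) - (b - a) * T powr \<gamma> = - l" "- R / 2 = - l"
      by (simp_all only: R_def) (simp_all add: algebra_simps)
    with truncated_convolution_error_le[OF \<gamma> f \<open>0 \<le> p\<close> R T less_imp_le[OF \<open>a < b\<close>] fb z]
    have "norm (f z - ?u z) \<le> (?D1 + ?D2) * exp (- l) * exp (- (a * \<bar>Re z\<bar> powr \<gamma>))"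
      by (simp add: distrib_right)
    also have "(?D1 + ?D2) * exp (- l) \<le> D * exp (- l)" by (simp add: D_def)
    also have "D * exp (- l) = 1 / r" using l \<open>1 \<le> D\<close> r by (simp add: exp_minus field_simps)
    finally show "norm (f z - ?u z) \<le> 1 / r * exp (- (a * \<bar>Re z\<bar> powr \<gamma>))"
      by (simp add: mult_right_mono)
  next
    fix h d :: real and z :: complex assume z: "\<bar>Im z\<bar> \<le> h"
    have "R * (h + 1) + \<bar>d - b\<bar> * T powr \<gamma>
        = (2 * (h + 1) + \<bar>d - b\<bar> * (2 * p + 3) / (b - a)) * l"
      by (simp add: R_def T\<gamma> field_simps)
    then have "exp (R * (h + 1) + \<bar>d - b\<bar> * T powr \<gamma>)
        = (D * r) powr (2 * (h + 1) + \<bar>d - b\<bar> * (2 * p + 3) / (b - a))"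
      using Dr by (simp only: powr_def l_def) auto
    moreover have "norm (f t) \<le> exp (- (b * \<bar>Re t\<bar> powr \<gamma>))" if "Im t = 0" for t
      using fb[of t] that \<open>0 \<le> p\<close> by simp
    ultimately show "norm (?u z) \<le> pi * transfer_const d * exp (h\<^sup>2)
        * (D * r) powr (2 * (h + 1) + \<bar>d - b\<bar> * (2 * p + 3) / (b - a))
        * exp (- (d * \<bar>Re z\<bar> powr \<gamma>))"
      using truncated_convolution_le[OF \<gamma> f T R _ z, of b d] by simp
  qed
qed

text \<open>The same decomposition for a fixed target strip and weight, with a natural exponent and for all
  \<open>r > 0\<close>.  For \<open>r < 1\<close> the function \<open>f\<close> itself is an admissible error, so \<open>u = 0\<close>.\<close>

lemma weighted_strip_decomposition_power:
  fixes a b d p h \<gamma> :: real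
  assumes \<gamma>: "0 < \<gamma>" "\<gamma> \<le> 1" and "0 \<le> p" "0 \<le> h" and ab: "a < b"
  obtains n C where "1 \<le> n" "0 < C"
    and "\<And>f r. 0 < r \<Longrightarrow> f holomorphic_on UNIV \<Longrightarrow>
      (\<And>t. \<bar>Im t\<bar> < p + 1 \<Longrightarrow> norm (f t) \<le> exp (- (b * \<bar>Re t\<bar> powr \<gamma>))) \<Longrightarrow>
      \<exists>u. u holomorphic_on UNIV
        \<and> (\<forall>z. \<bar>Im z\<bar> \<le> h \<longrightarrow> norm (u z) \<le> C * r ^ n * exp (- (d * \<bar>Re z\<bar> powr \<gamma>)))
        \<and> (\<forall>z. \<bar>Im z\<bar> \<le> p \<longrightarrow> norm (f z - u z) \<le> 1 / r * exp (- (a * \<bar>Re z\<bar> powr \<gamma>)))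
        \<and> (\<forall>h' d'. \<exists>B. \<forall>z. \<bar>Im z\<bar> \<le> h' \<longrightarrow> norm (u z) \<le> B * exp (- (d' * \<bar>Re z\<bar> powr \<gamma>)))"
proof (rule weighted_strip_decomposition[OF \<gamma> \<open>0 \<le> p\<close> ab])
  fix D
  assume D: "1 \<le> D" and decomp:
    "\<And>f r. f holomorphic_on UNIV \<Longrightarrow> 1 \<le> r \<Longrightarrow>
      (\<And>t. \<bar>Im t\<bar> \<le> p + 1 / 2 \<Longrightarrow> norm (f t) \<le> exp (- (b * \<bar>Re t\<bar> powr \<gamma>))) \<Longrightarrow>
      \<exists>u. u holomorphic_on UNIV
        \<and> (\<forall>z. \<bar>Im z\<bar> \<le> p \<longrightarrow> norm (f z - u z) \<le> 1 / r * exp (- (a * \<bar>Re z\<bar> powr \<gamma>)))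
        \<and> (\<forall>h d z. \<bar>Im z\<bar> \<le> h \<longrightarrow> norm (u z) \<le> pi * transfer_const d * exp (h\<^sup>2)
             * (D * r) powr (2 * (h + 1) + \<bar>d - b\<bar> * (2 * p + 3) / (b - a))
             * exp (- (d * \<bar>Re z\<bar> powr \<gamma>)))"
  define \<kappa> where "\<kappa> = 2 * (h + 1) + \<bar>d - b\<bar> * (2 * p + 3) / (b - a)"
  define n where "n = Suc (nat \<lceil>\<kappa>\<rceil>)"
  define C where "C = pi * transfer_const d * exp (h\<^sup>2) * D ^ n"
  have n: "\<kappa> \<le> real n" unfolding n_def by linarith
  have C: "0 < C" using D by (simp add: C_def transfer_const_pos)
  show thesis
  proof (rule that)
    show "1 \<le> n" by (simp add: n_def)
    show "0 < C" by (rule C)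
    fix f :: "complex \<Rightarrow> complex" and r :: real
    assume r: "0 < r" and fh: "f holomorphic_on UNIV"
      and fb: "\<And>t. \<bar>Im t\<bar> < p + 1 \<Longrightarrow> norm (f t) \<le> exp (- (b * \<bar>Re t\<bar> powr \<gamma>))"
    show "\<exists>u. u holomorphic_on UNIV
        \<and> (\<forall>z. \<bar>Im z\<bar> \<le> h \<longrightarrow> norm (u z) \<le> C * r ^ n * exp (- (d * \<bar>Re z\<bar> powr \<gamma>)))
        \<and> (\<forall>z. \<bar>Im z\<bar> \<le> p \<longrightarrow> norm (f z - u z) \<le> 1 / r * exp (- (a * \<bar>Re z\<bar> powr \<gamma>)))
        \<and> (\<forall>h' d'. \<exists>B. \<forall>z. \<bar>Im z\<bar> \<le> h' \<longrightarrow> norm (u z) \<le> B * exp (- (d' * \<bar>Re z\<bar> powr \<gamma>)))"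
    proof (cases "r < 1")
      case True
      have "norm (f z) \<le> 1 / r * exp (- (a * \<bar>Re z\<bar> powr \<gamma>))" if "\<bar>Im z\<bar> \<le> p" for z
      proof -
        have "norm (f z) \<le> exp (- (b * \<bar>Re z\<bar> powr \<gamma>))" using fb[of z] that by simp
        also have "\<dots> \<le> 1 * exp (- (a * \<bar>Re z\<bar> powr \<gamma>))" using ab by (simp add: mult_right_mono)
        also have "\<dots> \<le> 1 / r * exp (- (a * \<bar>Re z\<bar> powr \<gamma>))"
          using True r by (intro mult_right_mono) auto
        finally show ?thesis .
      qed
      moreover have "0 \<le> C * r ^ n * exp (- (d * \<bar>Re z\<bar> powr \<gamma>))" for z
        using C r by simp
      ultimately show ?thesis
        by (intro exI[of _ "\<lambda>_. 0"] conjI allI impI exI[of _ 0]) simp_all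
    next
      case False
      have "norm (f t) \<le> exp (- (b * \<bar>Re t\<bar> powr \<gamma>))" if "\<bar>Im t\<bar> \<le> p + 1 / 2" for t
        using fb[of t] that by simp
      from decomp[OF fh _ this, of r] False obtain u where uh: "u holomorphic_on UNIV"
        and err: "\<forall>z. \<bar>Im z\<bar> \<le> p \<longrightarrow> norm (f z - u z) \<le> 1 / r * exp (- (a * \<bar>Re z\<bar> powr \<gamma>))"
        and ub: "\<forall>h d z. \<bar>Im z\<bar> \<le> h \<longrightarrow> norm (u z) \<le> pi * transfer_const d * exp (h\<^sup>2)
             * (D * r) powr (2 * (h + 1) + \<bar>d - b\<bar> * (2 * p + 3) / (b - a))
             * exp (- (d * \<bar>Re z\<bar> powr \<gamma>))"
        by auto
      have "norm (u z) \<le> C * r ^ n * exp (- (d * \<bar>Re z\<bar> powr \<gamma>))" if "\<bar>Im z\<bar> \<le> h" for z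
      proof -
        have Dr: "1 \<le> D * r" using mult_mono[of 1 D 1 r] D False by simp
        have "norm (u z) \<le> pi * transfer_const d * exp (h\<^sup>2) * (D * r) powr \<kappa>
            * exp (- (d * \<bar>Re z\<bar> powr \<gamma>))"
          using ub that unfolding \<kappa>_def by blast
        also have "\<dots> \<le> pi * transfer_const d * exp (h\<^sup>2) * (D ^ n * r ^ n) * exp (- (d * \<bar>Re z\<bar> powr \<gamma>))"
        proof (intro mult_right_mono mult_left_mono)
          have "(D * r) powr \<kappa> \<le> (D * r) powr real n" using Dr n by (intro powr_mono) auto
          also have "\<dots> = D ^ n * r ^ n" using Dr by (simp add: powr_realpow power_mult_distrib)
          finally show "(D * r) powr \<kappa> \<le> D ^ n * r ^ n" .
        qed (use transfer_const_pos[of d] in auto)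
        finally show ?thesis by (simp add: C_def mult.assoc)
      qed
      with uh err ub show ?thesis by blast
    qed
  qed
qed

section \<open>Property Omega\<close>

theorem corollary4p5:
  fixes \<gamma> :: real
    and \<mu> :: "complex \<Rightarrow> real"
    and a :: "nat \<Rightarrow> real"
    and V :: "nat \<Rightarrow> complex \<Rightarrow> real"
    and \<Omega> :: "nat \<Rightarrow> complex set"
  assumes "0 < \<gamma>" and "\<gamma> \<le> 1"
    and "\<mu> = (\<lambda>z. \<bar>Re z\<bar> powr \<gamma>)"
    and "strict_mono_on {1..} a"
    and "(\<forall>n\<ge>1. a n < 0) \<or> (\<forall>n\<ge>1. a n \<ge> 0)"
    and "a \<longlonglongrightarrow> 0 \<or> filterlim a at_top sequentially"
    and "V = (\<lambda>n z. exp (a n * \<mu> z))"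
    and "\<Omega> = strip"
  shows "frechet_space.property_Omega fun_scale (OV \<Omega> V) (weighted_seminorm \<Omega> V)"
proof -
  have V: "V = (\<lambda>n z. exp (a n * \<bar>Re z\<bar> powr \<gamma>))" unfolding assms(3,7) ..
  have "frechet_space fun_scale (OV strip V) (weighted_seminorm strip V)"
    unfolding V by (rule frechet_space_OV_exp[OF assms(1,4)])
  then interpret frechet_space fun_scale "OV strip V" "weighted_seminorm strip V" .
  have weighted_le_iff: "norm w * V k z \<le> B \<longleftrightarrow> norm w \<le> B * exp (- (a k * \<bar>Re z\<bar> powr \<gamma>))"
    for w :: complex and k z B
  proof -
    have "norm w * exp x \<le> B \<longleftrightarrow> norm w \<le> B * exp (- x)" for x :: real
      by (simp add: exp_minus field_simps)
    then show ?thesis by (simp only: V)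
  qed
  have ballI: "g \<in> seminorm_ball k"
    if "g \<in> OV strip V" "1 \<le> k"
      "\<And>z. \<bar>Im z\<bar> \<le> real k \<Longrightarrow> norm (g z) \<le> exp (- (a k * \<bar>Re z\<bar> powr \<gamma>))" for g k
  proof -
    have "weighted_seminorm strip V k g \<le> 1"
      using that by (intro weighted_seminorm_least strip_nonempty) (auto simp: weighted_le_iff strip_def)
    then show ?thesis using that(1) by (simp add: seminorm_ball_def)
  qed
  have ballD: "norm (g z) \<le> exp (- (a k * \<bar>Re z\<bar> powr \<gamma>))"
    if "g \<in> seminorm_ball k" "1 \<le> k" "\<bar>Im z\<bar> < real k" for g k z
    using that weighted_seminorm_upper[of g strip V k z] weighted_le_iff[of "g z" k z 1]
    by (auto simp: seminorm_ball_def strip_def)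
  have "property_Omega"
    unfolding property_Omega_def
  proof (intro allI impI)
    fix m :: nat assume m: "1 \<le> m"
    have less: "a m < a (Suc m)" using strict_mono_onD[OF assms(4), of m "Suc m"] m by simp
    \<comment> \<open>one step in the index provides both the wider strip and the stronger weight\<close>
    show "\<exists>q\<ge>1. \<forall>k\<ge>1. \<exists>n\<ge>1. \<exists>C>0. \<forall>r>0. seminorm_ball q \<subseteq>
        {fun_scale (complex_of_real (C * r ^ n)) u + fun_scale (complex_of_real (1 / r)) v | u v.
           u \<in> seminorm_ball k \<and> v \<in> seminorm_ball m}"
    proof (rule exI[of _ "Suc m"], intro conjI allI impI)
      fix k :: nat assume k: "1 \<le> k"
      show "\<exists>n\<ge>1. \<exists>C>0. \<forall>r>0. seminorm_ball (Suc m) \<subseteq>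
        {fun_scale (complex_of_real (C * r ^ n)) u + fun_scale (complex_of_real (1 / r)) v | u v.
           u \<in> seminorm_ball k \<and> v \<in> seminorm_ball m}"
      proof (rule weighted_strip_decomposition_power
          [OF assms(1,2) of_nat_0_le_iff[of m] of_nat_0_le_iff[of k] less, of "a k"])
        fix n :: nat and C :: real
        assume n: "1 \<le> n" and C: "0 < C" and decomp: "\<And>f r. 0 < r \<Longrightarrow> f holomorphic_on UNIV \<Longrightarrow>
            (\<And>t. \<bar>Im t\<bar> < real m + 1 \<Longrightarrow> norm (f t) \<le> exp (- (a (Suc m) * \<bar>Re t\<bar> powr \<gamma>))) \<Longrightarrow>
            \<exists>u. u holomorphic_on UNIV
            \<and> (\<forall>z. \<bar>Im z\<bar> \<le> real k \<longrightarrow> norm (u z) \<le> C * r ^ n * exp (- (a k * \<bar>Re z\<bar> powr \<gamma>)))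
            \<and> (\<forall>z. \<bar>Im z\<bar> \<le> real m \<longrightarrow> norm (f z - u z) \<le> 1 / r * exp (- (a m * \<bar>Re z\<bar> powr \<gamma>)))
            \<and> (\<forall>h' d'. \<exists>B. \<forall>z. \<bar>Im z\<bar> \<le> h' \<longrightarrow> norm (u z) \<le> B * exp (- (d' * \<bar>Re z\<bar> powr \<gamma>)))"
        have "f \<in> {fun_scale (complex_of_real (C * r ^ n)) u + fun_scale (complex_of_real (1 / r)) v | u v.
           u \<in> seminorm_ball k \<and> v \<in> seminorm_ball m}"
          if r: "0 < r" and fq: "f \<in> seminorm_ball (Suc m)" for r f
        proof -
          have fE: "f \<in> OV strip V" using fq by (simp add: seminorm_ball_def)
          then have fh: "f holomorphic_on UNIV" by (simp add: OV_def)
          have fb: "norm (f t) \<le> exp (- (a (Suc m) * \<bar>Re t\<bar> powr \<gamma>))" if "\<bar>Im t\<bar> < real m + 1" for t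
            using ballD[OF fq, of t] that by simp
          obtain u where uh: "u holomorphic_on UNIV"
            and ub: "\<And>z. \<bar>Im z\<bar> \<le> real k \<Longrightarrow> norm (u z) \<le> C * r ^ n * exp (- (a k * \<bar>Re z\<bar> powr \<gamma>))"
            and err: "\<And>z. \<bar>Im z\<bar> \<le> real m \<Longrightarrow> norm (f z - u z) \<le> 1 / r * exp (- (a m * \<bar>Re z\<bar> powr \<gamma>))"
            and all: "\<And>h' d'. \<exists>B. \<forall>z. \<bar>Im z\<bar> \<le> h' \<longrightarrow> norm (u z) \<le> B * exp (- (d' * \<bar>Re z\<bar> powr \<gamma>))"
            using decomp[OF r fh fb] by blast
          have uE: "u \<in> OV strip V"
          proof (rule OV_I[OF uh])
            fix j :: nat
            obtain B where "\<forall>z. \<bar>Im z\<bar> \<le> real j \<longrightarrow> norm (u z) \<le> B * exp (- (a j * \<bar>Re z\<bar> powr \<gamma>))"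
              using all by blast
            then show "\<exists>B. \<forall>z\<in>strip j. norm (u z) * V j z \<le> B"
              by (intro exI[of _ B]) (simp add: weighted_le_iff strip_def)
          qed
          define u' where "u' = fun_scale (complex_of_real (1 / (C * r ^ n))) u"
          define v' where "v' = fun_scale (complex_of_real r) (f - u)"
          have Cr: "0 < C * r ^ n" using C r by simp
          have "u' \<in> seminorm_ball k"
          proof (rule ballI)
            show "u' \<in> OV strip V" unfolding u'_def by (intro subspace_scale[OF subspace_E] uE)
            show "norm (u' z) \<le> exp (- (a k * \<bar>Re z\<bar> powr \<gamma>))" if "\<bar>Im z\<bar> \<le> real k" for z
            proof -
              have "norm (u' z) = norm (u z) / (C * r ^ n)"
                using C r by (simp add: u'_def fun_scale_def norm_mult norm_divide norm_power)
              also have "\<dots> \<le> exp (- (a k * \<bar>Re z\<bar> powr \<gamma>))"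
                using ub[OF that] Cr by (simp add: pos_divide_le_eq mult.commute)
              finally show ?thesis .
            qed
          qed (rule k)
          moreover have "v' \<in> seminorm_ball m"
          proof (rule ballI)
            show "v' \<in> OV strip V"
              unfolding v'_def by (intro subspace_scale[OF subspace_E] subspace_diff[OF subspace_E] fE uE)
            show "norm (v' z) \<le> exp (- (a m * \<bar>Re z\<bar> powr \<gamma>))" if "\<bar>Im z\<bar> \<le> real m" for z
            proof -
              have "norm (v' z) = r * norm (f z - u z)"
                using r by (simp add: v'_def fun_scale_def norm_mult)
              also have "\<dots> \<le> r * (1 / r * exp (- (a m * \<bar>Re z\<bar> powr \<gamma>)))"
                using err[OF that] r by (intro mult_left_mono) auto
              finally show ?thesis using r by simp
            qed
          qed (rule m)
          moreover have "f = fun_scale (complex_of_real (C * r ^ n)) u' + fun_scale (complex_of_real (1 / r)) v'"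
          proof
            fix z
            have "complex_of_real (C * r ^ n) \<noteq> 0" using C r by simp
            then show "f z = (fun_scale (complex_of_real (C * r ^ n)) u'
                + fun_scale (complex_of_real (1 / r)) v') z"
              using r by (simp add: u'_def v'_def fun_scale_def)
          qed
          ultimately show ?thesis by blast
        qed
        then show "\<exists>n\<ge>1. \<exists>C>0. \<forall>r>0. seminorm_ball (Suc m) \<subseteq>
          {fun_scale (complex_of_real (C * r ^ n)) u + fun_scale (complex_of_real (1 / r)) v | u v.
             u \<in> seminorm_ball k \<and> v \<in> seminorm_ball m}"
          using n C by blast
      qed
    qed simp
  qed
  then show ?thesis using assms(8) by simp
qed

end
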